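(* Let $G$ be a $6$-dimensional almost-abelian Lie group with a left-invariant Hermitian structure $(\omega,J)$, let $\Psi$ be a left-invariant nowhere vanishing holomorphic $(3,0)$-form on $(G,J)$, and let $\tau,\alpha'\in\mathbb{R}$. Suppose that $(\omega,J)$ solves the Hull-Strominger system with flat bundle, i.e. $$i\partial\overline\partial\omega=\frac{\alpha'}{4}\operatorname{tr}(\Omega^\tau\wedge\Omega^\tau),\qquad d(\Vert\Psi\Vert_\omega\,\omega^2)=0,$$ where $\Omega^\tau$ is the curvature of the Gauduchon connection $\nabla^\tau$ of $(G,\omega,J)$. If $\nabla^\tau$ is an instanton with respect to $\omega$, then the Hermitian structure $(\omega,J)$ is Kähler.
   Context: A Lie group is almost-abelian if its Lie algebra has a codimension-one abelian ideal. A Hermitian metric is identified with its fundamental $(1,1)$-form $\omega$; Kähler means $d\omega=0$. $\Vert\Psi\Vert_\omega$ is the pointwise norm, $\Vert\Psi\Vert_\omega^2\,\omega^3/3!=i\,\Psi\wedge\overline\Psi$. Gauduchon connections: $\nabla^\tau=\frac{1+\tau}{2}\nabla^{Ch}+\frac{1-\tau}{2}\nabla^{B}$, where $\nabla^{Ch}$ is the Chern connection of $(\omega,J)$ and $\nabla^{B}$ the Bismut connection (the unique Hermitian connection with totally skew-symmetric torsion). In a left-invariant orthonormal frame, with connection 1-forms defined by $\nabla^\tau_Xe_j=\sum_i\sigma^i_j(X)e_i$, the curvature 2-forms are $\Omega^i_j=d\sigma^i_j+\sum_k\sigma^i_k\wedge\sigma^k_j$, and by convention $\operatorname{tr}(\Omega^\tau\wedge\Omega^\tau)=\sum_{1\le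 i<j\le6}\Omega^i_j\wedge\Omega^i_j$. A connection $\nabla$ is an instanton with respect to $\omega$ if its curvature $\Omega^\nabla$ satisfies $\omega^2\wedge\Omega^\nabla=0$, $(\Omega^\nabla)^{2,0}=(\Omega^\nabla)^{0,2}=0$ (types taken in the 2-form part of the curvature). *)

theory Defs
  imports
    "HOL-Analysis.Analysis"
    "HOL-Combinatorics.Permutations"
    "HOL-Library.Function_Algebras"
begin

section \<open>Lie groups\<close>

fun Ck_on :: "nat \<Rightarrow> 'a::euclidean_space set \<Rightarrow> ('a \<Rightarrow> 'b::real_normed_vector) \<Rightarrow> bool" where
  "Ck_on 0 S f \<longleftrightarrow> continuous_on S f"
| "Ck_on (Suc k) S f \<longleftrightarrow>
     f differentiable_on S \<and> (\<forall>v. Ck_on k S (\<lambda>x. frechet_derivative f (at x) v))"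

text \<open>Only used for open \<open>S\<close>.\<close>

definition smooth_on :: "'a::euclidean_space set \<Rightarrow> ('a \<Rightarrow> 'b::real_normed_vector) \<Rightarrow> bool" where
  "smooth_on S f \<longleftrightarrow> (\<forall>k. Ck_on k S f)"

type_synonym ('g, 'm) chart = "'g set \<times> ('g \<Rightarrow> 'm)"

definition chart_inv :: "('g, 'm) chart \<Rightarrow> 'm \<Rightarrow> 'g" where
  "chart_inv c = inv_into (fst c) (snd c)"

text \<open>A smooth manifold is a second countable Hausdorff space (here: a whole type) together with a
  smooth atlas; its dimension is the dimension of the model space \<open>'m\<close>.\<close>

locale smooth_manifold =
  fixes A :: "('g::{t2_space, second_countable_topology}, 'm::euclidean_space) chart set"
  assumes chart: "(U, \<phi>) \<in> A \<Longrightarrow>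
      open U \<and> open (\<phi> ` U) \<and> (\<exists>\<psi>. homeomorphism U (\<phi> ` U) \<phi> \<psi>)"
    and cover: "(\<Union>c\<in>A. fst c) = UNIV"
    and compatible: "\<lbrakk>(U, \<phi>) \<in> A; (V, \<psi>) \<in> A\<rbrakk> \<Longrightarrow>
      smooth_on (\<phi> ` (U \<inter> V)) (\<psi> \<circ> chart_inv (U, \<phi>))"

locale lie_group = smooth_manifold A + group mul one inverse
  for A :: "('g::{t2_space, second_countable_topology}, 'm::euclidean_space) chart set"
    and mul :: "'g \<Rightarrow> 'g \<Rightarrow> 'g" and one :: 'g and inverse :: "'g \<Rightarrow> 'g" +
  assumes continuous_mult: "continuous_on UNIV (\<lambda>(x, y). mul x y)"
    and continuous_inverse: "continuous_on UNIV inverse"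
    and smooth_mult: "\<lbrakk>a \<in> A; b \<in> A; c \<in> A\<rbrakk> \<Longrightarrow>
      smooth_on
        {(x, y). x \<in> snd a ` fst a \<and> y \<in> snd b ` fst b \<and>
                 mul (chart_inv a x) (chart_inv b y) \<in> fst c}
        (\<lambda>(x, y). snd c (mul (chart_inv a x) (chart_inv b y)))"
    and smooth_inverse: "\<lbrakk>a \<in> A; c \<in> A\<rbrakk> \<Longrightarrow>
      smooth_on {x. x \<in> snd a ` fst a \<and> inverse (chart_inv a x) \<in> fst c}
        (\<lambda>x. snd c (inverse (chart_inv a x)))"

definition smooth_functions ::
    "('g::topological_space, 'm::euclidean_space) chart set \<Rightarrow> ('g \<Rightarrow> real) set" where
  "smooth_functions A = {f. \<forall>c\<in>A. smooth_on (snd c ` fst c) (f \<circ> chart_inv c)}"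

text \<open>Pointwise scalar multiplication; addition, subtraction and multiplication of functions are
  the pointwise ones of \<^theory>\<open>HOL-Library.Function_Algebras\<close>.\<close>

instantiation "fun" :: (type, real_vector) real_vector
begin

definition scaleR_fun_def: "r *\<^sub>R f = (\<lambda>x. r *\<^sub>R f x)"

instance
  by standard (auto simp: scaleR_fun_def fun_eq_iff algebra_simps)

end

text \<open>Vector fields are the derivations of the algebra of smooth functions. They are normalised
  to be zero on non-smooth arguments, so that equality of operators is equality of vector fields.\<close>

type_synonym 'g vfield = "('g \<Rightarrow> real) \<Rightarrow> ('g \<Rightarrow> real)"

definition vector_field ::
    "('g::topological_space, 'm::euclidean_space) chart set \<Rightarrow> 'g vfield \<Rightarrow> bool" where
  "vector_field A X \<longleftrightarrow>
     (\<forall>f\<in>smooth_functions A. X f \<in> smooth_functions A) \<and>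
     (\<forall>f\<in>smooth_functions A. \<forall>h\<in>smooth_functions A. X (f + h) = X f + X h) \<and>
     (\<forall>f\<in>smooth_functions A. \<forall>r::real. X (r *\<^sub>R f) = r *\<^sub>R X f) \<and>
     (\<forall>f\<in>smooth_functions A. \<forall>h\<in>smooth_functions A. X (f * h) = X f * h + f * X h) \<and>
     (\<forall>f. f \<notin> smooth_functions A \<longrightarrow> X f = 0)"

definition lie_algebra ::
    "('g::topological_space, 'm::euclidean_space) chart set \<Rightarrow> ('g \<Rightarrow> 'g \<Rightarrow> 'g) \<Rightarrow> 'g vfield set" where
  "lie_algebra A mul =
     {X. vector_field A X \<and>
         (\<forall>f\<in>smooth_functions A. \<forall>a. X (f \<circ> mul a) = X f \<circ> mul a)}"

definition lie_bracket :: "'g vfield \<Rightarrow> 'g vfield \<Rightarrow> 'g vfield" where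
  "lie_bracket X Y = (\<lambda>f. X (Y f) - Y (X f))"

section \<open>Linear algebra on a subspace\<close>

text \<open>From here on \<open>L\<close> is a linear subspace (the Lie algebra of left-invariant vector fields) with
  bracket \<open>br\<close>. Left-invariant tensor fields on the group are identified with tensors on \<open>L\<close>; maps are
  only meaningful, and only compared, on arguments from \<open>L\<close>.\<close>

definition linear_on :: "'v::real_vector set \<Rightarrow> ('v \<Rightarrow> 'w::real_vector) \<Rightarrow> bool" where
  "linear_on L f \<longleftrightarrow>
     (\<forall>x\<in>L. \<forall>y\<in>L. f (x + y) = f x + f y) \<and> (\<forall>x\<in>L. \<forall>r::real. f (r *\<^sub>R x) = r *\<^sub>R f x)"

definition bilinear_on :: "'v::real_vector set \<Rightarrow> ('v \<Rightarrow> 'v \<Rightarrow> 'w::real_vector) \<Rightarrow> bool" where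
  "bilinear_on L h \<longleftrightarrow> (\<forall>x\<in>L. linear_on L (h x)) \<and> (\<forall>y\<in>L. linear_on L (\<lambda>x. h x y))"

definition almost_abelian :: "'v::real_vector set \<Rightarrow> ('v \<Rightarrow> 'v \<Rightarrow> 'v) \<Rightarrow> bool" where
  "almost_abelian L br \<longleftrightarrow>
     (\<exists>I. subspace I \<and> I \<subseteq> L \<and> dim L = dim I + 1 \<and>
          (\<forall>x\<in>L. \<forall>y\<in>I. br x y \<in> I) \<and> (\<forall>x\<in>I. \<forall>y\<in>I. br x y = 0))"

section \<open>Left-invariant differential forms\<close>

text \<open>A complex-valued left-invariant \<open>k\<close>-form is given by its values on lists of \<open>k\<close> left-invariant
  vector fields.\<close>

type_synonym 'v form = "'v list \<Rightarrow> complex"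

definition alternating_form :: "'v::real_vector set \<Rightarrow> nat \<Rightarrow> 'v form \<Rightarrow> bool" where
  "alternating_form L k \<alpha> \<longleftrightarrow>
     (\<forall>Xs. length Xs = k \<and> set Xs \<subseteq> L \<longrightarrow>
        (\<forall>i<k. linear_on L (\<lambda>x. \<alpha> (Xs[i := x]))) \<and>
        (\<forall>i<k. \<forall>j<k. i \<noteq> j \<and> Xs ! i = Xs ! j \<longrightarrow> \<alpha> Xs = 0))"

definition form_eq :: "'v set \<Rightarrow> nat \<Rightarrow> 'v form \<Rightarrow> 'v form \<Rightarrow> bool" where
  "form_eq L k \<alpha> \<beta> \<longleftrightarrow> (\<forall>Xs. length Xs = k \<and> set Xs \<subseteq> L \<longrightarrow> \<alpha> Xs = \<beta> Xs)"

definition wedge :: "nat \<Rightarrow> nat \<Rightarrow> 'v form \<Rightarrow> 'v form \<Rightarrow> 'v form" where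
  "wedge k l \<alpha> \<beta> Xs =
     (\<Sum>p | p permutes {..<k + l}.
        of_int (sign p) * \<alpha> (map (\<lambda>i. Xs ! p i) [0..<k]) * \<beta> (map (\<lambda>i. Xs ! p i) [k..<k + l]))
     / (fact k * fact l)"

text \<open>The Koszul formula for the exterior derivative; the terms that differentiate
  \<open>\<alpha>(X\<^sub>0, \<dots>)\<close> are absent because this function is constant on the group.\<close>

definition ext_d :: "('v \<Rightarrow> 'v \<Rightarrow> 'v) \<Rightarrow> 'v form \<Rightarrow> 'v form" where
  "ext_d br \<alpha> Xs =
     (\<Sum>j<length Xs. \<Sum>i<j. (-1) ^ (i + j) * \<alpha> (br (Xs ! i) (Xs ! j) # nths Xs (- {i, j})))"

text \<open>The \<open>(p,q)\<close>-component of a \<open>(p+q)\<close>-form: the sum over \<open>S\<close> of the (complex multilinearly extended)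
  values on \<open>(X\<^sub>j - \<i> J X\<^sub>j)/2\<close> for \<open>j \<in> S\<close> and \<open>(X\<^sub>j + \<i> J X\<^sub>j)/2\<close> for \<open>j \<notin> S\<close>,
  expanded over the set \<open>T\<close> of the slots in which the \<open>J\<close>-summand is taken.\<close>

definition type_part :: "('v \<Rightarrow> 'v) \<Rightarrow> nat \<Rightarrow> nat \<Rightarrow> 'v form \<Rightarrow> 'v form" where
  "type_part J p q \<alpha> Xs =
     (\<Sum>S | S \<subseteq> {..<p + q} \<and> card S = p. \<Sum>T\<in>Pow {..<p + q}.
        (\<Prod>j\<in>T. if j \<in> S then - \<i> else \<i>) / 2 ^ (p + q)
        * \<alpha> (map (\<lambda>j. if j \<in> T then J (Xs ! j) else Xs ! j) [0..<p + q]))"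

definition has_type :: "'v set \<Rightarrow> ('v \<Rightarrow> 'v) \<Rightarrow> nat \<Rightarrow> nat \<Rightarrow> 'v form \<Rightarrow> bool" where
  "has_type L J p q \<alpha> \<longleftrightarrow> form_eq L (p + q) (type_part J p q \<alpha>) \<alpha>"

text \<open>\<open>\<partial>\<close> and \<open>\<partial>\<close>-bar on forms of type \<open>(p,q)\<close>.\<close>

definition del :: "('v \<Rightarrow> 'v \<Rightarrow> 'v) \<Rightarrow> ('v \<Rightarrow> 'v) \<Rightarrow> nat \<Rightarrow> nat \<Rightarrow> 'v form \<Rightarrow> 'v form" where
  "del br J p q \<alpha> = type_part J (p + 1) q (ext_d br \<alpha>)"

definition delbar :: "('v \<Rightarrow> 'v \<Rightarrow> 'v) \<Rightarrow> ('v \<Rightarrow> 'v) \<Rightarrow> nat \<Rightarrow> nat \<Rightarrow> 'v form \<Rightarrow> 'v form" where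
  "delbar br J p q \<alpha> = type_part J p (q + 1) (ext_d br \<alpha>)"

section \<open>Left-invariant Hermitian structures\<close>

definition complex_structure ::
    "'v::real_vector set \<Rightarrow> ('v \<Rightarrow> 'v \<Rightarrow> 'v) \<Rightarrow> ('v \<Rightarrow> 'v) \<Rightarrow> bool" where
  "complex_structure L br J \<longleftrightarrow>
     linear_on L J \<and> (\<forall>x\<in>L. J x \<in> L \<and> J (J x) = - x) \<and>
     (\<forall>x\<in>L. \<forall>y\<in>L. br (J x) (J y) - J (br (J x) y) - J (br x (J y)) - br x y = 0)"

definition hermitian_structure ::
    "'v::real_vector set \<Rightarrow> ('v \<Rightarrow> 'v \<Rightarrow> 'v) \<Rightarrow> ('v \<Rightarrow> 'v \<Rightarrow> real) \<Rightarrow> ('v \<Rightarrow> 'v) \<Rightarrow> bool" where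
  "hermitian_structure L br g J \<longleftrightarrow>
     complex_structure L br J \<and>
     bilinear_on L g \<and> (\<forall>x\<in>L. \<forall>y\<in>L. g x y = g y x) \<and> (\<forall>x\<in>L. x \<noteq> 0 \<longrightarrow> 0 < g x x) \<and>
     (\<forall>x\<in>L. \<forall>y\<in>L. g (J x) (J y) = g x y)"

definition fundamental_form :: "('v \<Rightarrow> 'v \<Rightarrow> real) \<Rightarrow> ('v \<Rightarrow> 'v) \<Rightarrow> 'v form" where
  "fundamental_form g J Xs = complex_of_real (g (J (Xs ! 0)) (Xs ! 1))"

definition kaehler ::
    "'v set \<Rightarrow> ('v \<Rightarrow> 'v \<Rightarrow> 'v) \<Rightarrow> ('v \<Rightarrow> 'v \<Rightarrow> real) \<Rightarrow> ('v \<Rightarrow> 'v) \<Rightarrow> bool" where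
  "kaehler L br g J \<longleftrightarrow> form_eq L 3 (ext_d br (fundamental_form g J)) (\<lambda>_. 0)"

definition orthonormal_frame ::
    "'v::real_vector set \<Rightarrow> ('v \<Rightarrow> 'v \<Rightarrow> real) \<Rightarrow> nat \<Rightarrow> (nat \<Rightarrow> 'v) \<Rightarrow> bool" where
  "orthonormal_frame L g n e \<longleftrightarrow>
     e ` {1..n} \<subseteq> L \<and> span (e ` {1..n}) = L \<and>
     (\<forall>i\<in>{1..n}. \<forall>j\<in>{1..n}. g (e i) (e j) = (if i = j then 1 else 0))"

text \<open>Left-invariant (hence nowhere vanishing as soon as it is nonzero) holomorphic
  \<open>(3,0)\<close>-forms.\<close>

definition holomorphic_volume_form ::
    "'v::real_vector set \<Rightarrow> ('v \<Rightarrow> 'v \<Rightarrow> 'v) \<Rightarrow> ('v \<Rightarrow> 'v) \<Rightarrow> 'v form \<Rightarrow> bool" where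
  "holomorphic_volume_form L br J \<Psi> \<longleftrightarrow>
     alternating_form L 3 \<Psi> \<and> has_type L J 3 0 \<Psi> \<and>
     \<not> form_eq L 3 \<Psi> (\<lambda>_. 0) \<and> form_eq L 4 (delbar br J 3 0 \<Psi>) (\<lambda>_. 0)"

definition form_square :: "'v form \<Rightarrow> 'v form" where
  "form_square \<omega> = wedge 2 2 \<omega> \<omega>"

definition form_cube :: "'v form \<Rightarrow> 'v form" where
  "form_cube \<omega> = wedge 4 2 (form_square \<omega>) \<omega>"

definition volume_norm :: "'v set \<Rightarrow> 'v form \<Rightarrow> 'v form \<Rightarrow> real" where
  "volume_norm L \<omega> \<Psi> =
     (THE c. 0 \<le> c \<and>
        form_eq L 6 (\<lambda>Xs. complex_of_real (c\<^sup>2) * form_cube \<omega> Xs / fact 3)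
                    (\<lambda>Xs. \<i> * wedge 3 3 \<Psi> (\<lambda>Ys. cnj (\<Psi> Ys)) Xs))"

section \<open>Gauduchon connections\<close>

definition hermitian_connection ::
    "'v::real_vector set \<Rightarrow> ('v \<Rightarrow> 'v \<Rightarrow> real) \<Rightarrow> ('v \<Rightarrow> 'v) \<Rightarrow> ('v \<Rightarrow> 'v \<Rightarrow> 'v) \<Rightarrow> bool" where
  "hermitian_connection L g J D \<longleftrightarrow>
     bilinear_on L D \<and> (\<forall>x\<in>L. \<forall>y\<in>L. D x y \<in> L) \<and>
     (\<forall>x\<in>L. \<forall>y\<in>L. \<forall>z\<in>L. g (D x y) z + g y (D x z) = 0) \<and>
     (\<forall>x\<in>L. \<forall>y\<in>L. D x (J y) = J (D x y))"

definition torsion :: "('v::ab_group_add \<Rightarrow> 'v \<Rightarrow> 'v) \<Rightarrow> ('v \<Rightarrow> 'v \<Rightarrow> 'v) \<Rightarrow> 'v \<Rightarrow> 'v \<Rightarrow> 'v" where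
  "torsion br D x y = D x y - D y x - br x y"

text \<open>The Chern connection is the unique Hermitian connection whose torsion, a vector-valued
  \<open>2\<close>-form, has vanishing \<open>(1,1)\<close>-component.\<close>

definition chern_connection ::
    "'v::real_vector set \<Rightarrow> ('v \<Rightarrow> 'v \<Rightarrow> 'v) \<Rightarrow> ('v \<Rightarrow> 'v \<Rightarrow> real) \<Rightarrow> ('v \<Rightarrow> 'v) \<Rightarrow> ('v \<Rightarrow> 'v \<Rightarrow> 'v) \<Rightarrow> bool"
  where
  "chern_connection L br g J D \<longleftrightarrow>
     hermitian_connection L g J D \<and>
     (\<forall>z\<in>L. form_eq L 2
        (type_part J 1 1 (\<lambda>Xs. complex_of_real (g (torsion br D (Xs ! 0) (Xs ! 1)) z))) (\<lambda>_. 0))"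

text \<open>Skew-symmetry of the torsion in its first two arguments is automatic.\<close>

definition bismut_connection ::
    "'v::real_vector set \<Rightarrow> ('v \<Rightarrow> 'v \<Rightarrow> 'v) \<Rightarrow> ('v \<Rightarrow> 'v \<Rightarrow> real) \<Rightarrow> ('v \<Rightarrow> 'v) \<Rightarrow> ('v \<Rightarrow> 'v \<Rightarrow> 'v) \<Rightarrow> bool"
  where
  "bismut_connection L br g J D \<longleftrightarrow>
     hermitian_connection L g J D \<and>
     (\<forall>x\<in>L. \<forall>y\<in>L. \<forall>z\<in>L. g (torsion br D x y) z = - g (torsion br D x z) y)"

definition gauduchon_connection ::
    "'v::real_vector set \<Rightarrow> ('v \<Rightarrow> 'v \<Rightarrow> 'v) \<Rightarrow> ('v \<Rightarrow> 'v \<Rightarrow> real) \<Rightarrow> ('v \<Rightarrow> 'v) \<Rightarrow> real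
      \<Rightarrow> ('v \<Rightarrow> 'v \<Rightarrow> 'v) \<Rightarrow> bool" where
  "gauduchon_connection L br g J \<tau> D \<longleftrightarrow>
     (\<exists>Dc Db. chern_connection L br g J Dc \<and> bismut_connection L br g J Db \<and>
        (\<forall>x\<in>L. \<forall>y\<in>L. D x y = ((1 + \<tau>) / 2) *\<^sub>R Dc x y + ((1 - \<tau>) / 2) *\<^sub>R Db x y))"

text \<open>In an orthonormal frame \<open>e\<close>, the coefficient of \<open>e i\<close> in \<open>D X (e j)\<close> is
  \<open>g (D X (e j)) (e i)\<close>.\<close>

definition conn_form ::
    "('v \<Rightarrow> 'v \<Rightarrow> real) \<Rightarrow> (nat \<Rightarrow> 'v) \<Rightarrow> ('v \<Rightarrow> 'v \<Rightarrow> 'v) \<Rightarrow> nat \<Rightarrow> nat \<Rightarrow> 'v form" where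
  "conn_form g e D i j Xs = complex_of_real (g (D (Xs ! 0) (e j)) (e i))"

definition curv_form ::
    "('v \<Rightarrow> 'v \<Rightarrow> 'v) \<Rightarrow> ('v \<Rightarrow> 'v \<Rightarrow> real) \<Rightarrow> (nat \<Rightarrow> 'v) \<Rightarrow> ('v \<Rightarrow> 'v \<Rightarrow> 'v) \<Rightarrow> nat \<Rightarrow> nat \<Rightarrow> 'v form"
  where
  "curv_form br g e D i j Xs =
     ext_d br (conn_form g e D i j) Xs
     + (\<Sum>k\<in>{1..6}. wedge 1 1 (conn_form g e D i k) (conn_form g e D k j) Xs)"

definition tr_curv_square ::
    "('v \<Rightarrow> 'v \<Rightarrow> 'v) \<Rightarrow> ('v \<Rightarrow> 'v \<Rightarrow> real) \<Rightarrow> (nat \<Rightarrow> 'v) \<Rightarrow> ('v \<Rightarrow> 'v \<Rightarrow> 'v) \<Rightarrow> 'v form" where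
  "tr_curv_square br g e D Xs =
     (\<Sum>j\<in>{1..6}. \<Sum>i\<in>{1..<j}. form_square (curv_form br g e D i j) Xs)"

definition instanton ::
    "'v set \<Rightarrow> ('v \<Rightarrow> 'v \<Rightarrow> 'v) \<Rightarrow> ('v \<Rightarrow> 'v \<Rightarrow> real) \<Rightarrow> ('v \<Rightarrow> 'v) \<Rightarrow> (nat \<Rightarrow> 'v) \<Rightarrow> ('v \<Rightarrow> 'v \<Rightarrow> 'v) \<Rightarrow> bool"
  where
  "instanton L br g J e D \<longleftrightarrow>
     (\<forall>i\<in>{1..6}. \<forall>j\<in>{1..6}.
        form_eq L 6 (wedge 4 2 (form_square (fundamental_form g J)) (curv_form br g e D i j)) (\<lambda>_. 0) \<and>
        form_eq L 2 (type_part J 2 0 (curv_form br g e D i j)) (\<lambda>_. 0) \<and>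
        form_eq L 2 (type_part J 0 2 (curv_form br g e D i j)) (\<lambda>_. 0))"

text \<open>The Hull--Strominger system with flat bundle: the anomaly equation (without gauge term) and the
  conformally balanced equation.\<close>

definition hull_strominger_flat ::
    "'v set \<Rightarrow> ('v \<Rightarrow> 'v \<Rightarrow> 'v) \<Rightarrow> ('v \<Rightarrow> 'v \<Rightarrow> real) \<Rightarrow> ('v \<Rightarrow> 'v) \<Rightarrow> 'v form \<Rightarrow> (nat \<Rightarrow> 'v)
      \<Rightarrow> ('v \<Rightarrow> 'v \<Rightarrow> 'v) \<Rightarrow> real \<Rightarrow> bool" where
  "hull_strominger_flat L br g J \<Psi> e D \<alpha>' \<longleftrightarrow>
     (let \<omega> = fundamental_form g J in
        form_eq L 4 (\<lambda>Xs. \<i> * del br J 1 2 (delbar br J 1 1 \<omega>) Xs)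
                    (\<lambda>Xs. complex_of_real (\<alpha>' / 4) * tr_curv_square br g e D Xs) \<and>
        form_eq L 5 (ext_d br (\<lambda>Xs. complex_of_real (volume_norm L \<omega> \<Psi>) * form_square \<omega> Xs)) (\<lambda>_. 0))"

end

theory Submission
  imports Defs
begin

text \<open>The statement concerns the six-dimensional space \<open>L\<close> of left-invariant vector fields with its
bracket, metric \<open>g\<close> and complex structure \<open>J\<close>. Let \<open>z\<close> be a unit normal of the abelian ideal and
\<open>A = [z, \<cdot>]\<close>. As the ideal is abelian, the whole bracket is
\<open>[x, y] = g(z, x) A y - g(z, y) A x\<close>, and \<open>L\<close> is the orthogonal sum of the complex line through \<open>z\<close>
and a complex plane \<open>N\<close>. Integrability of \<open>J\<close> says that \<open>A\<close> maps \<open>N\<close> to itself and commutes with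
\<open>J\<close> there (\<open>A_J_N\<close>, \<open>A_N\<close>).

The conformally balanced equation and the holomorphic volume form normalise \<open>A\<close>. The norm of \<open>\<Psi>\<close> is
a positive constant (\<open>volume_norm_pos\<close>), so the equation is \<open>d(\<omega>\<^sup>2) = 0\<close>; it says that \<open>A\<close> has trace
zero on \<open>N\<close> and that \<open>A (J z) = a J z\<close> for a number \<open>a\<close> (\<open>balanced_trace\<close>, \<open>balanced_A_Jz\<close>).
Holomorphy of \<open>\<Psi>\<close> says that the sum of \<open>a\<close> and the complex trace of \<open>A\<close> on \<open>N\<close> vanishes, and its
real part gives \<open>a = 0\<close> (\<open>A_Jz_eq_0_of_holomorphic\<close>). Now \<open>A\<close> commutes with \<open>J\<close> on all of \<open>L\<close> and
takes values in \<open>N\<close>. With \<open>s(x, y) = g(A x, y) + g(x, A y)\<close>, which is twice the symmetric part of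
\<open>A\<close>, the form \<open>d\<omega>\<close> is minus the wedge product of \<open>g(z, \<cdot>)\<close> and \<open>s(J \<cdot>, \<cdot>)\<close>; hence \<open>s = 0\<close> implies
that the structure is Kaehler.

Explicit formulas for the Chern and Bismut connections (\<open>chern_formula\<close>, \<open>bismut_formula\<close>) give
\<open>g(D\<^sub>x z, y) = - (1 - \<tau>)/4 s(x, y)\<close> for the Gauduchon connection \<open>D\<close> with parameter \<open>\<tau>\<close>.

If \<open>\<tau> \<noteq> 1\<close>, take the entry of the curvature that pairs \<open>z\<close> with \<open>J z\<close>. Its contraction with \<open>\<omega>\<close> is
a negative multiple of the sum of \<open>|D\<^sub>f z|\<^sup>2\<close> over a unitary frame, and the instanton condition
\<open>\<omega>\<^sup>2 \<and> \<Omega> = 0\<close> says that it vanishes. So \<open>s = 0\<close> (\<open>s_eq_0_of_instanton\<close>).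

If \<open>\<tau> = 1\<close>, then \<open>D\<close> is the Chern connection and \<open>D\<^sub>x = 0\<close> for \<open>x\<close> in \<open>N\<close>. Hence the curvature
vanishes as soon as one argument lies in \<open>N\<close>, and \<open>tr(\<Omega> \<and> \<Omega>)\<close> is zero on \<open>(z, J z, x, J x)\<close>. The
left-hand side of the anomaly equation there is \<open>s(A x, x)\<close> (\<open>anomaly_form_eq\<close>). The sum of these numbers over an
orthonormal frame is half the squared norm of \<open>s\<close>, so again \<open>s = 0\<close> (\<open>s_eq_0_of_trace\<close>).

The computations with forms rest on \<open>wedge_Cons\<close>: the interior product with a vector is an
antiderivation of the wedge product. It turns the sums over all permutations into short sums over
shuffles (\<open>wedge_eq_shuffle_sum\<close>).\<close>

section \<open>Wedge products as sums over shuffles\<close>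

text \<open>The cycle \<open>m \<mapsto> 0 \<mapsto> 1 \<mapsto> \<dots> \<mapsto> m\<close>. Composing a permutation that fixes \<open>0\<close> with it gives one that sends
\<open>m\<close> to \<open>0\<close>; it is written as a product of transpositions so that its sign is immediate.\<close>

fun front_cycle :: "nat \<Rightarrow> nat \<Rightarrow> nat" where
  "front_cycle 0 = id"
| "front_cycle (Suc m) = front_cycle m \<circ> Transposition.transpose m (Suc m)"

lemma front_cycle_apply:
  "front_cycle m i = (if i < m then Suc i else if i = m then 0 else i)"
  by (induction m arbitrary: i) (auto simp: Transposition.transpose_def)

lemma front_cycle_permutes: "m < n \<Longrightarrow> front_cycle m permutes {..<n}"
proof (induction m)
  case (Suc m)
  have "Transposition.transpose m (Suc m) permutes {..<n}" using Suc.prems by (intro permutes_swap_id) auto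
  moreover have "front_cycle m permutes {..<n}" using Suc by simp
  ultimately show ?case unfolding front_cycle.simps by (rule permutes_compose)
qed (simp add: permutes_id[unfolded id_def] flip: id_def)

lemma sign_front_cycle: "sign (front_cycle m) = (-1) ^ m"
proof (induction m)
  case (Suc m)
  have "permutation (front_cycle m)"
    using front_cycle_permutes[of m "Suc m"] by (auto simp: permutation_permutes)
  then have "sign (front_cycle m \<circ> Transposition.transpose m (Suc m)) =
      sign (front_cycle m) * sign (Transposition.transpose m (Suc m))"
    by (rule sign_compose) (rule permutation_swap_id)
  then show ?case by (simp only: front_cycle.simps) (simp add: Suc sign_swap_id)
qed simp

lemma permutes_fixing_zero:
  "{r. r permutes {..<Suc N} \<and> r 0 = 0} = {r. r permutes Suc ` {..<N}}"
proof (intro set_eqI iffI; clarsimp)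
  fix r assume "r permutes {..<Suc N}" "r 0 = (0::nat)"
  then show "r permutes Suc ` {..<N}"
    by (elim permutes_superset) (auto simp: image_iff less_Suc_eq_0_disj)
next
  fix r assume "r permutes Suc ` {..<N}"
  then show "r permutes {..<Suc N} \<and> r 0 = 0"
    using permutes_subset[of r "Suc ` {..<N}" "{..<Suc N}"]  permutes_not_in[of r "Suc ` {..<N}" 0] by auto
qed

text \<open>The permutations \<open>p\<close> with \<open>p m = 0\<close> are those of one number fewer, shifted by one and composed with
the cycle that moves slot \<open>m\<close> to the front. This is what reduces a wedge product to one of smaller
degree.\<close>

lemma sum_permutes_sending_to_zero:
  fixes h :: "(nat \<Rightarrow> nat) \<Rightarrow> 'a::comm_ring_1"
  assumes "m \<le> N"
  shows "(\<Sum>p | p permutes {..<Suc N} \<and> p m = 0. of_int (sign p) * h p)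
       = (-1) ^ m * (\<Sum>q | q permutes {..<N}. of_int (sign q) *
            h (map_permutation {..<N} Suc q \<circ> front_cycle m))"
proof -
  let ?c = "front_cycle m"
  have c: "?c permutes {..<Suc N}" using assms by (intro front_cycle_permutes) auto
  have "(\<Sum>p | p permutes {..<Suc N} \<and> p m = 0. of_int (sign p) * h p)
      = (\<Sum>r | r permutes {..<Suc N} \<and> r 0 = 0. of_int (sign (r \<circ> ?c)) * h (r \<circ> ?c))"
  proof (rule sum.reindex_bij_witness[where i = "\<lambda>r. r \<circ> ?c" and j = "\<lambda>p. p \<circ> inv ?c"])
    fix p assume p: "p \<in> {p. p permutes {..<Suc N} \<and> p m = 0}"
    show pc: "p \<circ> inv ?c \<circ> ?c = p" by (simp add: comp_assoc permutes_inv_o[OF c])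
    have "inv ?c 0 = m" using c by (auto simp: permutes_inv_eq front_cycle_apply)
    then show "p \<circ> inv ?c \<in> {r. r permutes {..<Suc N} \<and> r 0 = 0}"
      using p by (auto intro: permutes_compose permutes_inv c)
    show "of_int (sign (p \<circ> inv ?c \<circ> ?c)) * h (p \<circ> inv ?c \<circ> ?c) = of_int (sign p) * h p"
      by (simp add: pc)
  next
    fix r assume r: "r \<in> {r. r permutes {..<Suc N} \<and> r 0 = 0}"
    show "r \<circ> ?c \<circ> inv ?c = r" by (simp add: comp_assoc permutes_inv_o[OF c])
    show "r \<circ> ?c \<in> {p. p permutes {..<Suc N} \<and> p m = 0}"
      using r by (auto intro: permutes_compose c simp: front_cycle_apply)
  qed
  also have "\<dots> = (\<Sum>r | r permutes {..<Suc N} \<and> r 0 = 0. (-1) ^ m * (of_int (sign r) * h (r \<circ> ?c)))"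
  proof (rule sum.cong)
    fix r assume "r \<in> {r. r permutes {..<Suc N} \<and> r 0 = 0}"
    then have "permutation r" "permutation ?c" using c by (auto simp: permutation_permutes)
    then show "of_int (sign (r \<circ> ?c)) * h (r \<circ> ?c) = (-1) ^ m * (of_int (sign r) * h (r \<circ> ?c))"
      by (simp add: sign_compose sign_front_cycle mult_ac)
  qed simp
  also have "\<dots> = (-1) ^ m * (\<Sum>r | r permutes Suc ` {..<N}. of_int (sign r) * h (r \<circ> ?c))"
    by (simp only: permutes_fixing_zero sum_distrib_left)
  also have "(\<Sum>r | r permutes Suc ` {..<N}. of_int (sign r) * h (r \<circ> ?c)) =
     (\<Sum>q | q permutes {..<N}. of_int (sign (map_permutation {..<N} Suc q)) *
            h (map_permutation {..<N} Suc q \<circ> ?c))"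
  proof (rule sum.reindex_bij_betw[symmetric])
    have "bij_betw Suc {..<N} (Suc ` {..<N})" by (simp add: bij_betw_def)
    from bij_betw_permutations[OF this]
    show "bij_betw (map_permutation {..<N} Suc) {q. q permutes {..<N}} {r. r permutes Suc ` {..<N}}"
      by (simp add: map_permutation_def[abs_def] restrict_id_def o_def)
  qed
  also have "\<dots> = (\<Sum>q | q permutes {..<N}. of_int (sign q) *
            h (map_permutation {..<N} Suc q \<circ> ?c))"
    by (intro sum.cong) (auto simp: sign_map_permutation)
  finally show ?thesis .
qed

lemma alternating_form_linear:
  "\<lbrakk>alternating_form L k \<alpha>; length Xs = k; set Xs \<subseteq> L; i < k\<rbrakk> \<Longrightarrow> linear_on L (\<lambda>x. \<alpha> (Xs[i := x]))"
  unfolding alternating_form_def by blast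

lemma alternating_form_eq_0:
  "\<lbrakk>alternating_form L k \<alpha>; length Xs = k; set Xs \<subseteq> L; i < k; j < k; i \<noteq> j; Xs ! i = Xs ! j\<rbrakk>
    \<Longrightarrow> \<alpha> Xs = 0"
  unfolding alternating_form_def by blast

lemma alternating_formI:
  assumes "\<And>Xs i. \<lbrakk>length Xs = k; set Xs \<subseteq> L; i < k\<rbrakk> \<Longrightarrow> linear_on L (\<lambda>x. \<alpha> (Xs[i := x]))"
    and "\<And>Xs i j. \<lbrakk>length Xs = k; set Xs \<subseteq> L; i < k; j < k; i \<noteq> j; Xs ! i = Xs ! j\<rbrakk> \<Longrightarrow> \<alpha> Xs = 0"
  shows "alternating_form L k \<alpha>"
  using assms unfolding alternating_form_def by blast

text \<open>Vanishing on repeated arguments gives antisymmetry by expanding the value at \<open>x + y\<close> in both slots.\<close>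

lemma alternating_form_swap:
  assumes a: "alternating_form L k \<alpha>" and "subspace L"
    and Xs: "length Xs = k" "set Xs \<subseteq> L" and ij: "i < k" "j < k" "i \<noteq> j"
  shows "\<alpha> (Xs[i := Xs ! j, j := Xs ! i]) = - \<alpha> Xs"
proof -
  let ?x = "Xs ! i" and ?y = "Xs ! j"
  let ?F = "\<lambda>a b. \<alpha> (Xs[i := a, j := b])"
  have L: "?x \<in> L" "?y \<in> L" "?x + ?y \<in> L"
    using Xs ij assms(2) by (auto simp: subset_iff subspace_add)
  have diag: "?F a a = 0" if "a \<in> L" for a
    using that Xs ij by (intro alternating_form_eq_0[OF a, of _ i j] set_update_subsetI) auto
  have 1: "?F (a + a') b = ?F a b + ?F a' b" if "a \<in> L" "a' \<in> L" "b \<in> L" for a a' b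
    using alternating_form_linear[OF a, of "Xs[j := b]" i] that Xs ij
    by (simp add: list_update_swap[of i j] linear_on_def set_update_subsetI)
  have 2: "?F a (b + b') = ?F a b + ?F a b'" if "a \<in> L" "b \<in> L" "b' \<in> L" for a b b'
    using alternating_form_linear[OF a, of "Xs[i := a]" j] that Xs ij
    by (simp add: linear_on_def set_update_subsetI)
  have "?F (?x + ?y) (?x + ?y) = ?F ?x (?x + ?y) + ?F ?y (?x + ?y)" using L by (intro 1)
  also have "\<dots> = (?F ?x ?x + ?F ?x ?y) + (?F ?y ?x + ?F ?y ?y)" using L by (intro arg_cong2[where f = "(+)"] 2)
  finally have "?F ?y ?x + ?F ?x ?y = 0" using L diag by (simp only:) (simp add: add.commute)
  then show ?thesis by (simp add: eq_neg_iff_add_eq_0)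
qed

lemma alternating_form_interior:
  assumes a: "alternating_form L (Suc k) \<alpha>" and "X \<in> L"
  shows "alternating_form L k (\<lambda>Ys. \<alpha> (X # Ys))"
proof (rule alternating_formI)
  fix Xs i assume "length Xs = k" "set Xs \<subseteq> L" "i < k"
  then show "linear_on L (\<lambda>x. \<alpha> (X # Xs[i := x]))"
    using alternating_form_linear[OF a, of "X # Xs" "Suc i"] assms(2) by simp
next
  fix Xs i j assume "length Xs = k" "set Xs \<subseteq> L" "i < k" "j < k" "i \<noteq> j" "Xs ! i = Xs ! j"
  then show "\<alpha> (X # Xs) = 0"
    using alternating_form_eq_0[OF a, of "X # Xs" "Suc i" "Suc j"] assms(2) by simp
qed

definition wedge_summand :: "nat \<Rightarrow> nat \<Rightarrow> 'v form \<Rightarrow> 'v form \<Rightarrow> 'v list \<Rightarrow> (nat \<Rightarrow> nat) \<Rightarrow> complex" where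
  "wedge_summand k l \<alpha> \<beta> Xs p =
     \<alpha> (map (\<lambda>i. Xs ! p i) [0..<k]) * \<beta> (map (\<lambda>i. Xs ! p i) [k..<k + l])"

lemma wedge_alt_def:
  "wedge k l \<alpha> \<beta> Xs =
     (\<Sum>p | p permutes {..<k + l}. of_int (sign p) * wedge_summand k l \<alpha> \<beta> Xs p) / (fact k * fact l)"
  by (simp add: wedge_def wedge_summand_def mult.assoc)

lemma map_nth_transpose:
  assumes "i \<in> {a..<b}" "j \<in> {a..<b}" "i \<noteq> j"
  shows "map (\<lambda>m. f (Transposition.transpose i j m)) [a..<b]
      = (map f [a..<b])[i - a := f j, j - a := f i]"
  using assms by (intro nth_equalityI) (auto simp: nth_list_update Transposition.transpose_def)

lemma map_transpose_outside:
  assumes "i \<notin> {a..<b}" "j \<notin> {a..<b}"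
  shows "map (\<lambda>m. f (Transposition.transpose i j m)) [a..<b] = map f [a..<b]"
  using assms by (auto simp: Transposition.transpose_def)

text \<open>A transposition within the first \<open>k\<close> or within the last \<open>l\<close> slots changes the sign of both the
summand and the permutation. Hence in the sum defining the wedge product it does not matter which of
the slots of one factor receives a given vector.\<close>

lemma wedge_summand_transpose:
  assumes \<alpha>: "alternating_form L k \<alpha>" and \<beta>: "alternating_form L l \<beta>" and L: "subspace L"
    and Xs: "length Xs = k + l" "set Xs \<subseteq> L" and p: "p permutes {..<k + l}"
    and ij: "i \<noteq> j" "i < k \<and> j < k \<or> i \<in> {k..<k + l} \<and> j \<in> {k..<k + l}"
  shows "wedge_summand k l \<alpha> \<beta> Xs (p \<circ> Transposition.transpose i j) = - wedge_summand k l \<alpha> \<beta> Xs p"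
proof -
  have mem: "Xs ! p m \<in> L" if "m < k + l" for m
    using that Xs permutes_in_image[OF p, of m] by (auto simp: subset_iff)
  have sub: "set (map (\<lambda>m. Xs ! p m) [a..<b]) \<subseteq> L" if "b \<le> k + l" for a b
    using that by (auto intro!: mem)
  from ij(2) show ?thesis
  proof
    assume *: "i < k \<and> j < k"
    then have "map (\<lambda>m. Xs ! p (Transposition.transpose i j m)) [0..<k]
      = (map (\<lambda>m. Xs ! p m) [0..<k])[i := map (\<lambda>m. Xs ! p m) [0..<k] ! j, j := map (\<lambda>m. Xs ! p m) [0..<k] ! i]"
      using map_nth_transpose[of i 0 k j "\<lambda>m. Xs ! p m"] ij(1) by simp
    moreover have "\<beta> (map (\<lambda>m. Xs ! p (Transposition.transpose i j m)) [k..<k + l]) = \<beta> (map (\<lambda>m. Xs ! p m) [k..<k + l])"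
      using * by (intro arg_cong[where f = \<beta>] map_transpose_outside) auto
    ultimately show ?thesis using *
        alternating_form_swap[OF \<alpha> L, of "map (\<lambda>m. Xs ! p m) [0..<k]" i j] sub[of k 0] ij(1)
      by (simp add: wedge_summand_def)
  next
    assume *: "i \<in> {k..<k + l} \<and> j \<in> {k..<k + l}"
    then have "map (\<lambda>m. Xs ! p (Transposition.transpose i j m)) [k..<k + l]
      = (map (\<lambda>m. Xs ! p m) [k..<k + l])[i - k := map (\<lambda>m. Xs ! p m) [k..<k + l] ! (j - k),
           j - k := map (\<lambda>m. Xs ! p m) [k..<k + l] ! (i - k)]"
      using map_nth_transpose[of i k "k + l" j "\<lambda>m. Xs ! p m"] ij(1) by auto
    moreover have "\<alpha> (map (\<lambda>m. Xs ! p (Transposition.transpose i j m)) [0..<k]) = \<alpha> (map (\<lambda>m. Xs ! p m) [0..<k])"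
      using * by (intro arg_cong[where f = \<alpha>] map_transpose_outside) auto
    ultimately show ?thesis using *
        alternating_form_swap[OF \<beta> L, of "map (\<lambda>m. Xs ! p m) [k..<k + l]" "i - k" "j - k"]
        sub[of "k + l" k] ij(1)
      by (auto simp add: wedge_summand_def)
  qed
qed

lemma wedge_summand_sum_transpose:
  assumes \<alpha>: "alternating_form L k \<alpha>" and \<beta>: "alternating_form L l \<beta>" and L: "subspace L"
    and Xs: "length Xs = k + l" "set Xs \<subseteq> L"
    and ij: "i < k \<and> j < k \<or> i \<in> {k..<k + l} \<and> j \<in> {k..<k + l}"
  shows "(\<Sum>p | p permutes {..<k + l} \<and> p j = 0. of_int (sign p) * wedge_summand k l \<alpha> \<beta> Xs p)
    = (\<Sum>p | p permutes {..<k + l} \<and> p i = 0. of_int (sign p) * wedge_summand k l \<alpha> \<beta> Xs p)"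
proof (cases "i = j")
  case False
  let ?t = "Transposition.transpose i j"
  have t: "?t permutes {..<k + l}" using ij by (intro permutes_swap_id) auto
  show ?thesis
  proof (rule sum.reindex_bij_witness[where i = "\<lambda>p. p \<circ> ?t" and j = "\<lambda>p. p \<circ> ?t"])
    fix p assume p: "p \<in> {p. p permutes {..<k + l} \<and> p j = 0}"
    then have "sign (p \<circ> ?t) = - sign p"
      using False t by (subst sign_compose) (auto simp: permutation_permutes permutation_swap_id sign_swap_id)
    then show "of_int (sign (p \<circ> ?t)) * wedge_summand k l \<alpha> \<beta> Xs (p \<circ> ?t)
        = of_int (sign p) * wedge_summand k l \<alpha> \<beta> Xs p"
      using p False ij by (subst wedge_summand_transpose[OF \<alpha> \<beta> L Xs]) auto
  qed (use permutes_compose[OF t] in \<open>auto simp: comp_assoc\<close>)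
qed simp

text \<open>The interior product with \<open>X\<close> is an antiderivation. The permutations are sorted by the slot that
receives \<open>X\<close>: the \<open>k\<close> slots of the first factor contribute equally, and so do the \<open>l\<close> slots of the
second, which changes the normalising factorials \<open>k! l!\<close> to \<open>(k-1)! l!\<close> and \<open>k! (l-1)!\<close>.\<close>

theorem wedge_Cons:
  assumes \<alpha>: "alternating_form L k \<alpha>" and \<beta>: "alternating_form L l \<beta>" and L: "subspace L"
    and X: "X \<in> L" and Xs: "set Xs \<subseteq> L" "Suc (length Xs) = k + l"
  shows "wedge k l \<alpha> \<beta> (X # Xs) =
     (if k = 0 then 0 else wedge (k - 1) l (\<lambda>Ys. \<alpha> (X # Ys)) \<beta> Xs) +
     (if l = 0 then 0 else (-1) ^ k * wedge k (l - 1) \<alpha> (\<lambda>Ys. \<beta> (X # Ys)) Xs)"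
proof -
  let ?N = "length Xs" and ?Zs = "X # Xs"
  let ?F = "\<lambda>p. of_int (sign p) * wedge_summand k l \<alpha> \<beta> ?Zs p"
  let ?S = "\<lambda>j. \<Sum>p | p permutes {..<k + l} \<and> p j = 0. ?F p"
  have Zs: "length ?Zs = k + l" "set ?Zs \<subseteq> L" using X Xs by auto
  have "(\<Sum>p | p permutes {..<k + l}. ?F p)
      = (\<Sum>p | p permutes {..<k + l}. \<Sum>j<k + l. if p j = 0 then ?F p else 0)"
  proof (rule sum.cong[OF refl])
    fix p assume "p \<in> {p. p permutes {..<k + l}}"
    then have p: "p permutes {..<k + l}" by simp
    have "p j = 0 \<longleftrightarrow> j = inv p 0" for j using permutes_inv_eq[OF p, of 0 j] by auto
    moreover have "inv p 0 < k + l"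
      using permutes_in_image[OF permutes_inv[OF p], of 0] Xs(2) by auto
    ultimately show "?F p = (\<Sum>j<k + l. if p j = 0 then ?F p else 0)" by simp
  qed
  also have "\<dots> = (\<Sum>j<k + l. ?S j)"
  proof (subst sum.swap, rule sum.cong[OF refl])
    fix j
    show "(\<Sum>p | p permutes {..<k + l}. if p j = 0 then ?F p else 0) = ?S j"
      using sum.inter_filter[OF finite_permutations[OF finite_lessThan], of "\<lambda>p. ?F p" "k + l" "\<lambda>p. p j = 0"]
      by (simp only: mem_Collect_eq)
  qed
  also have "\<dots> = (\<Sum>j<k. ?S j) + (\<Sum>j\<in>{k..<k + l}. ?S j)"
    unfolding lessThan_atLeast0 by (rule sum.atLeastLessThan_concat[symmetric]) simp_all
  finally have split: "(\<Sum>p | p permutes {..<k + l}. ?F p) = (\<Sum>j<k. ?S j) + (\<Sum>j\<in>{k..<k + l}. ?S j)" .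
  have S0: "?S j = ?S 0" if "j < k" for j
  proof (rule wedge_summand_sum_transpose[OF \<alpha> \<beta> L Zs, of 0 j])
    show "0 < k \<and> j < k \<or> 0 \<in> {k..<k + l} \<and> j \<in> {k..<k + l}" using that by simp
  qed
  have "(\<Sum>j<k. ?S j) = (\<Sum>j<k. ?S 0)" by (rule sum.cong[OF refl], rule S0) simp
  then have first: "(\<Sum>j<k. ?S j) = of_nat k * ?S 0" by simp
  have Sk: "?S j = ?S k" if "j \<in> {k..<k + l}" for j
  proof (rule wedge_summand_sum_transpose[OF \<alpha> \<beta> L Zs, of k j])
    show "k < k \<and> j < k \<or> k \<in> {k..<k + l} \<and> j \<in> {k..<k + l}" using that by simp
  qed
  have "(\<Sum>j\<in>{k..<k + l}. ?S j) = (\<Sum>j\<in>{k..<k + l}. ?S k)" by (rule sum.cong[OF refl], rule Sk)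
  then have second: "(\<Sum>j\<in>{k..<k + l}. ?S j) = of_nat l * ?S k" by simp
  have sum: "(\<Sum>p | p permutes {..<k + l}. ?F p) = of_nat k * ?S 0 + of_nat l * ?S k"
    by (simp only: split first second)
  have shift: "?S m = (-1) ^ m * (\<Sum>q | q permutes {..<?N}. of_int (sign q) *
     wedge_summand k l \<alpha> \<beta> ?Zs (map_permutation {..<?N} Suc q \<circ> front_cycle m))" if "m \<le> ?N" for m
    using sum_permutes_sending_to_zero[OF that] by (simp flip: Xs(2))
  have 0: "wedge_summand k l \<alpha> \<beta> ?Zs (map_permutation {..<?N} Suc q \<circ> front_cycle 0)
      = wedge_summand (k - 1) l (\<lambda>Ys. \<alpha> (X # Ys)) \<beta> Xs q"
    if q: "q permutes {..<?N}" and "k \<noteq> 0" for q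
  proof -
    let ?q = "map_permutation {..<?N} Suc q"
    have q0: "?q 0 = 0" by (simp add: map_permutation_def restrict_id_def)
    have qS: "?q (Suc i) = Suc (q i)" if "i < ?N" for i using that by (simp add: map_permutation_apply)
    have "map (\<lambda>i. ?Zs ! ?q i) [0..<k] = X # map (\<lambda>i. Xs ! q i) [0..<k - 1]"
      using that(2) Xs(2) q0 qS by (intro nth_equalityI) (auto simp: nth_Cons' gr0_conv_Suc)
    moreover have "map (\<lambda>i. ?Zs ! ?q i) [k..<k + l] = map (\<lambda>i. Xs ! q i) [k - 1..<k - 1 + l]"
      using that(2) Xs(2) qS by (intro nth_equalityI) (auto simp: gr0_conv_Suc)
    ultimately show ?thesis by (simp add: wedge_summand_def)
  qed
  have k: "wedge_summand k l \<alpha> \<beta> ?Zs (map_permutation {..<?N} Suc q \<circ> front_cycle k)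
      = wedge_summand k (l - 1) \<alpha> (\<lambda>Ys. \<beta> (X # Ys)) Xs q"
    if q: "q permutes {..<?N}" and "l \<noteq> 0" for q
  proof -
    let ?q = "map_permutation {..<?N} Suc q"
    have q0: "?q 0 = 0" by (simp add: map_permutation_def restrict_id_def)
    have qS: "?q (Suc i) = Suc (q i)" if "i < ?N" for i using that by (simp add: map_permutation_apply)
    have "map (\<lambda>i. ?Zs ! ?q (front_cycle k i)) [k..<k + l] = X # map (\<lambda>i. Xs ! q i) [k..<k + (l - 1)]"
    proof (intro nth_equalityI)
      fix i assume "i < length (map (\<lambda>i. ?Zs ! ?q (front_cycle k i)) [k..<k + l])"
      then show "map (\<lambda>i. ?Zs ! ?q (front_cycle k i)) [k..<k + l] ! i
          = (X # map (\<lambda>i. Xs ! q i) [k..<k + (l - 1)]) ! i"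
        using that(2) Xs(2) q0 qS[of "k + (i - 1)"] by (cases i) (auto simp: front_cycle_apply)
    qed (use that(2) in simp)
    moreover have "\<alpha> (map (\<lambda>i. ?Zs ! ?q (front_cycle k i)) [0..<k]) = \<alpha> (map (\<lambda>i. Xs ! q i) [0..<k])"
      using that(2) Xs(2) qS by (intro arg_cong[where f = \<alpha>] nth_equalityI) (auto simp: front_cycle_apply)
    ultimately show ?thesis by (simp add: wedge_summand_def)
  qed
  have "of_nat k * ?S 0 / (fact k * fact l) =
      (if k = 0 then 0 else wedge (k - 1) l (\<lambda>Ys. \<alpha> (X # Ys)) \<beta> Xs)"
  proof (cases k)
    case (Suc k')
    then have "k - 1 + l = ?N" using Xs(2) by simp
    then have "?S 0 = wedge (k - 1) l (\<lambda>Ys. \<alpha> (X # Ys)) \<beta> Xs * (fact (k - 1) * fact l)"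
      using shift[of 0] 0 Suc by (simp add: wedge_alt_def)
    then show ?thesis using Suc by (simp del: of_nat_Suc)
  qed simp
  moreover have "of_nat l * ?S k / (fact k * fact l) =
      (if l = 0 then 0 else (-1) ^ k * wedge k (l - 1) \<alpha> (\<lambda>Ys. \<beta> (X # Ys)) Xs)"
  proof (cases l)
    case (Suc l')
    then have "k + (l - 1) = ?N" using Xs(2) by simp
    then have "?S k = (-1) ^ k * wedge k (l - 1) \<alpha> (\<lambda>Ys. \<beta> (X # Ys)) Xs * (fact k * fact (l - 1))"
      using shift[of k] k Suc by (simp add: wedge_alt_def)
    then show ?thesis using Suc by (simp del: of_nat_Suc)
  qed simp
  ultimately show ?thesis by (simp only: wedge_alt_def[of k l] sum add_divide_distrib)
qed

lemma wedge_0_0: "wedge 0 0 \<alpha> \<beta> [] = \<alpha> [] * \<beta> []"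
  by (simp add: wedge_def)

text \<open>If two arguments agree, composing a permutation with their transposition does not change the product of
the values of the factors and reverses the sign, so the sum equals its own negative.\<close>

lemma alternating_wedge:
  assumes \<alpha>: "alternating_form L k \<alpha>" and \<beta>: "alternating_form L l \<beta>" 
  shows "alternating_form L (k + l) (wedge k l \<alpha> \<beta>)"
proof (rule alternating_formI)
  fix Xs i assume Xs: "length Xs = k + l" "set Xs \<subseteq> L" and i: "i < k + l"
  have lin: "linear_on L (\<lambda>x. wedge_summand k l \<alpha> \<beta> (Xs[i := x]) p)" if p: "p permutes {..<k + l}" for p
  proof -
    define j where "j = inv p i"
    have pj: "p m = i \<longleftrightarrow> m = j" for m using permutes_inv_eq[OF p, of i m] by (auto simp: j_def)
    have j: "j < k + l" using permutes_in_image[OF permutes_inv[OF p], of i] i by (simp add: j_def)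
    have mem: "p m < k + l" if "m < k + l" for m
      using permutes_in_image[OF p, of m] that by auto
    have nth: "Xs[i := x] ! p m = (if m = j then x else Xs ! p m)" if "m < k + l" for x m
      using that mem[of m] pj[of m] i Xs(1) by auto
    have upd: "map (\<lambda>m. Xs[i := x] ! p m) [a..<b] =
        (if j \<in> {a..<b} then (map (\<lambda>m. Xs ! p m) [a..<b])[j - a := x] else map (\<lambda>m. Xs ! p m) [a..<b])"
      if "b \<le> k + l" for x a b
      using that by (intro nth_equalityI) (auto simp: nth_list_update nth)
    have sub: "set (map (\<lambda>m. Xs ! p m) [a..<b]) \<subseteq> L" if "b \<le> k + l" for a b
      using that mem Xs by (auto simp: subset_iff)
    show ?thesis
    proof (cases "j < k")
      case True
      then show ?thesis
        using alternating_form_linear[OF \<alpha>, of "map (\<lambda>m. Xs ! p m) [0..<k]" j] sub[of k 0]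
        by (simp add: wedge_summand_def upd linear_on_def distrib_right)
    next
      case False
      then show ?thesis
        using alternating_form_linear[OF \<beta>, of "map (\<lambda>m. Xs ! p m) [k..<k + l]" "j - k"] sub[of "k + l" k] j
        by (simp add: wedge_summand_def upd linear_on_def distrib_left)
    qed
  qed
  then show "linear_on L (\<lambda>x. wedge k l \<alpha> \<beta> (Xs[i := x]))"
    unfolding wedge_alt_def linear_on_def
    by (simp add: distrib_left sum.distrib add_divide_distrib scaleR_sum_right
        sum_divide_distrib sum_distrib_left scaleR_conv_of_real mult_ac)
next
  fix Xs i j assume Xs: "length Xs = k + l" "set Xs \<subseteq> L" and ij: "i < k + l" "j < k + l" "i \<noteq> j" "Xs ! i = Xs ! j"
  let ?t = "Transposition.transpose i j"
  let ?W = "\<Sum>p | p permutes {..<k + l}. of_int (sign p) * wedge_summand k l \<alpha> \<beta> Xs p"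
  have t: "?t permutes {..<k + l}" using ij by (intro permutes_swap_id) auto
  have "?W = (\<Sum>p | p permutes {..<k + l}. of_int (sign (?t \<circ> p)) * wedge_summand k l \<alpha> \<beta> Xs (?t \<circ> p))"
    by (rule setum_permutations_compose_left[OF t])
  also have "\<dots> = (\<Sum>p | p permutes {..<k + l}. - (of_int (sign p) * wedge_summand k l \<alpha> \<beta> Xs p))"
  proof (rule sum.cong[OF refl])
    fix p assume "p \<in> {p. p permutes {..<k + l}}"
    then have "sign (?t \<circ> p) = - sign p"
      using ij(3) t by (subst sign_compose) (auto simp: permutation_permutes permutation_swap_id sign_swap_id)
    moreover have "Xs ! ?t m = Xs ! m" for m using ij(4) by (auto simp: Transposition.transpose_def)
    ultimately show "of_int (sign (?t \<circ> p)) * wedge_summand k l \<alpha> \<beta> Xs (?t \<circ> p)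
        = - (of_int (sign p) * wedge_summand k l \<alpha> \<beta> Xs p)"
      by (simp add: wedge_summand_def)
  qed
  finally have "?W = - ?W" by (simp add: sum_negf)
  then show "wedge k l \<alpha> \<beta> Xs = 0" by (simp add: wedge_alt_def)
qed

lemma alternating_form_append:
  assumes "alternating_form L (length As + k) \<alpha>" and "set As \<subseteq> L"
  shows "alternating_form L k (\<lambda>Ys. \<alpha> (As @ Ys))"
  using assms
proof (induction As arbitrary: \<alpha>)
  case (Cons X As)
  then have "alternating_form L (length As + k) (\<lambda>Ys. \<alpha> (X # Ys))"
    by (intro alternating_form_interior) auto
  from Cons.IH[OF this] Cons.prems show ?case by simp
qed simp

text \<open>The recursion unfolded by iterating \<open>wedge_Cons\<close>: each vector goes to the end of the list of
arguments of the first factor, which still lacks \<open>k\<close> of them, or to that of the second, with the sign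
\<open>(-1) ^ k\<close> for passing the \<open>k\<close> open slots. On an explicit list it evaluates to the sum over all shuffles.\<close>

fun shuffle_sum :: "nat \<Rightarrow> nat \<Rightarrow> 'v form \<Rightarrow> 'v form \<Rightarrow> 'v list \<Rightarrow> 'v list \<Rightarrow> 'v list \<Rightarrow> complex" where
  "shuffle_sum k l \<alpha> \<beta> As Bs [] = \<alpha> As * \<beta> Bs"
| "shuffle_sum k l \<alpha> \<beta> As Bs (X # Xs) =
     (if k = 0 then 0 else shuffle_sum (k - 1) l \<alpha> \<beta> (As @ [X]) Bs Xs) +
     (if l = 0 then 0 else (-1) ^ k * shuffle_sum k (l - 1) \<alpha> \<beta> As (Bs @ [X]) Xs)"

theorem wedge_eq_shuffle_sum:
  assumes "alternating_form L k \<alpha>" and "alternating_form L l \<beta>" and L: "subspace L"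
    and "set Xs \<subseteq> L" and "length Xs = k + l"
  shows "wedge k l \<alpha> \<beta> Xs = shuffle_sum k l \<alpha> \<beta> [] [] Xs"
proof -
  have "wedge k l (\<lambda>Ys. \<alpha> (As @ Ys)) (\<lambda>Ys. \<beta> (Bs @ Ys)) Xs = shuffle_sum k l \<alpha> \<beta> As Bs Xs"
    if "alternating_form L (length As + k) \<alpha>" "alternating_form L (length Bs + l) \<beta>"
      "set As \<subseteq> L" "set Bs \<subseteq> L" "set Xs \<subseteq> L" "length Xs = k + l" for k l As Bs Xs
    using that
  proof (induction Xs arbitrary: k l As Bs)
    case Nil
    then show ?case by (simp add: wedge_0_0)
  next
    case (Cons X Xs)
    have 1: "wedge (k - 1) l (\<lambda>Ys. \<alpha> (As @ X # Ys)) (\<lambda>Ys. \<beta> (Bs @ Ys)) Xs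
        = shuffle_sum (k - 1) l \<alpha> \<beta> (As @ [X]) Bs Xs" if "k \<noteq> 0"
      using Cons.IH[of "As @ [X]" "k - 1" Bs l] Cons.prems that by simp
    have 2: "wedge k (l - 1) (\<lambda>Ys. \<alpha> (As @ Ys)) (\<lambda>Ys. \<beta> (Bs @ X # Ys)) Xs
        = shuffle_sum k (l - 1) \<alpha> \<beta> As (Bs @ [X]) Xs" if "l \<noteq> 0"
      using Cons.IH[of As k "Bs @ [X]" "l - 1"] Cons.prems that by simp
    have "wedge k l (\<lambda>Ys. \<alpha> (As @ Ys)) (\<lambda>Ys. \<beta> (Bs @ Ys)) (X # Xs) =
      (if k = 0 then 0 else wedge (k - 1) l (\<lambda>Ys. \<alpha> (As @ X # Ys)) (\<lambda>Ys. \<beta> (Bs @ Ys)) Xs) +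
      (if l = 0 then 0 else (-1) ^ k * wedge k (l - 1) (\<lambda>Ys. \<alpha> (As @ Ys)) (\<lambda>Ys. \<beta> (Bs @ X # Ys)) Xs)"
      using Cons.prems by (intro wedge_Cons[OF _ _ L] alternating_form_append) auto
    then show ?case using 1 2 by auto
  qed
  from this[of "[]" k "[]" l Xs] assms show ?thesis by simp
qed

lemma wedge_2_2:
  assumes "alternating_form L 2 \<alpha>" "alternating_form L 2 \<beta>" "subspace L" "a \<in> L" "b \<in> L" "c \<in> L" "d \<in> L"
  shows "wedge 2 2 \<alpha> \<beta> [a, b, c, d] = \<alpha> [a, b] * \<beta> [c, d] - \<alpha> [a, c] * \<beta> [b, d] + \<alpha> [a, d] * \<beta> [b, c]
      + \<alpha> [b, c] * \<beta> [a, d] - \<alpha> [b, d] * \<beta> [a, c] + \<alpha> [c, d] * \<beta> [a, b]"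
  using assms by (subst wedge_eq_shuffle_sum[OF assms(1-3)]) simp_all

section \<open>Multilinearity and forms of top degree\<close>

lemma linear_on_zero_span:
  assumes "linear_on L f" and "subspace L" and S: "S \<subseteq> L" "\<And>x. x \<in> S \<Longrightarrow> f x = 0" and x: "x \<in> span S"
  shows "f x = 0"
proof -
  have "x \<in> L \<and> f x = 0"
    using x
  proof (rule span_induct)
    have "f 0 = 0" using assms(1,2) subspace_0 unfolding linear_on_def by (metis scaleR_zero_left)
    then show "subspace {x. x \<in> L \<and> f x = 0}"
      using assms(1,2) unfolding linear_on_def subspace_def by auto
  qed (use S in auto)
  then show ?thesis ..
qed

lemma linear_on_sum:
  assumes "linear_on L f" "subspace L" "finite K" "\<And>k. k \<in> K \<Longrightarrow> h k \<in> L"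
  shows "f (\<Sum>k\<in>K. c k *\<^sub>R h k) = (\<Sum>k\<in>K. c k *\<^sub>R f (h k))"
  using assms(3,4)
proof (induction K)
  case empty
  have "f (0 *\<^sub>R 0) = 0 *\<^sub>R f 0" using assms(1,2) subspace_0 unfolding linear_on_def by blast
  then show ?case by simp
next
  case (insert k K)
  then have "c k *\<^sub>R h k \<in> L" "(\<Sum>k\<in>K. c k *\<^sub>R h k) \<in> L"
    using assms(2) by (auto intro!: subspace_sum subspace_scale)
  then show ?case using insert assms(1) by (simp add: linear_on_def)
qed

lemma alternating_form_cong:
  assumes "subspace L" "alternating_form L k \<beta>" "form_eq L k \<alpha> \<beta>"
  shows "alternating_form L k \<alpha>"
proof (rule alternating_formI)
  fix Xs i assume Xs: "length Xs = k" "set Xs \<subseteq> L" "i < k"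
  have "\<alpha> (Xs[i := x]) = \<beta> (Xs[i := x])" if "x \<in> L" for x
    using assms(3) Xs that by (simp add: form_eq_def set_update_subsetI)
  then show "linear_on L (\<lambda>x. \<alpha> (Xs[i := x]))"
    using alternating_form_linear[OF assms(2) Xs] assms(1)
    by (simp add: linear_on_def subspace_add subspace_scale)
next
  fix Xs i j assume "length Xs = k" "set Xs \<subseteq> L" "i < k" "j < k" "i \<noteq> j" "Xs ! i = Xs ! j"
  then show "\<alpha> Xs = 0"
    using alternating_form_eq_0[OF assms(2), of Xs i j] assms(3) by (simp add: form_eq_def)
qed

lemma alternating_form_lincomb:
  assumes "alternating_form L k \<alpha>" "alternating_form L k \<beta>"
  shows "alternating_form L k (\<lambda>Xs. a * \<alpha> Xs + b * \<beta> Xs)"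
proof (rule alternating_formI)
  fix Xs i assume Xs: "length Xs = k" "set Xs \<subseteq> L" "i < k"
  show "linear_on L (\<lambda>x. a * \<alpha> (Xs[i := x]) + b * \<beta> (Xs[i := x]))"
    using alternating_form_linear[OF assms(1) Xs] alternating_form_linear[OF assms(2) Xs]
    by (simp add: linear_on_def scaleR_conv_of_real algebra_simps)
next
  fix Xs i j assume "length Xs = k" "set Xs \<subseteq> L" "i < k" "j < k" "i \<noteq> j" "Xs ! i = Xs ! j"
  then show "a * \<alpha> Xs + b * \<beta> Xs = 0"
    using alternating_form_eq_0[OF assms(1), of Xs i j] alternating_form_eq_0[OF assms(2), of Xs i j] by simp
qed

lemma alternating_two_form:
  assumes "bilinear_on L f" "\<And>x. x \<in> L \<Longrightarrow> f x x = 0"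
  shows "alternating_form L 2 (\<lambda>Xs. complex_of_real (f (Xs ! 0) (Xs ! 1)))"
proof (rule alternating_formI)
  fix Xs i assume Xs: "length Xs = 2" "set Xs \<subseteq> L" and i: "i < (2::nat)"
  from Xs obtain a b where ab: "Xs = [a, b]" "a \<in> L" "b \<in> L" by (auto simp: numeral_2_eq_2 length_Suc_conv)
  from i have "i = 0 \<or> i = 1" by auto
  then show "linear_on L (\<lambda>x. complex_of_real (f (Xs[i := x] ! 0) (Xs[i := x] ! 1)))"
    using assms(1) ab by (auto simp: bilinear_on_def linear_on_def scaleR_conv_of_real)
next
  fix Xs i j assume Xs: "length Xs = 2" "set Xs \<subseteq> L" and i: "i < (2::nat)" "j < 2" "i \<noteq> j" "Xs ! i = Xs ! j"
  from Xs obtain a b where ab: "Xs = [a, b]" "a \<in> L" "b \<in> L" by (auto simp: numeral_2_eq_2 length_Suc_conv)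
  then have "a = b" using i by (auto simp: less_2_cases_iff)
  then show "complex_of_real (f (Xs ! 0) (Xs ! 1)) = 0" using ab assms(2) by simp
qed

lemma alternating_form_permute_eq_0:
  assumes a: "alternating_form L k \<alpha>" and L: "subspace L" and Xs: "length Xs = k" "set Xs \<subseteq> L"
    and 0: "\<alpha> Xs = 0" and p: "p permutes {..<k}"
  shows "\<alpha> (map (\<lambda>i. Xs ! p i) [0..<k]) = 0"
  using finite_lessThan[of k] p
proof (induction p rule: permutes_rev_induct)
  case id
  have "map (\<lambda>i. Xs ! i) [0..<k] = Xs" using map_nth[of Xs] Xs(1) by simp
  then show ?case using 0 by simp
next
  case (swap i j p)
  let ?Ys = "map (\<lambda>i. Xs ! p i) [0..<k]"
  have "set ?Ys \<subseteq> L" using Xs permutes_in_image[OF swap.hyps(4)] by (auto simp: subset_iff)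
  then have "\<alpha> (?Ys[i := ?Ys ! j, j := ?Ys ! i]) = - \<alpha> ?Ys"
    using swap.hyps by (intro alternating_form_swap[OF a L]) auto
  moreover have "map (\<lambda>m. Xs ! (p \<circ> Transposition.transpose i j) m) [0..<k] = ?Ys[i := ?Ys ! j, j := ?Ys ! i]"
    using map_nth_transpose[of i 0 k j "\<lambda>m. Xs ! p m"] swap.hyps by simp
  ultimately show ?case using swap.IH by simp
qed

text \<open>A form of degree \<open>n\<close> on a space spanned by \<open>n\<close> vectors is determined by its value on them: slot by slot,
multilinearity reduces to arguments from the spanning list, and there the arguments repeat or are
a permutation of the list.\<close>

lemma top_form_eq_0:
  assumes a: "alternating_form L n \<alpha>" and L: "subspace L"
    and bs: "length bs = n" "span (set bs) = L" "\<alpha> bs = 0"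
  shows "form_eq L n \<alpha> (\<lambda>_. 0)"
proof -
  have bsL: "set bs \<subseteq> L" using bs(2) span_superset by blast
  have basis: "\<alpha> Ys = 0" if Ys: "length Ys = n" "set Ys \<subseteq> set bs" for Ys
  proof (cases "distinct Ys")
    case True
    then have "card (set Ys) = n" using Ys by (simp add: distinct_card)
    then have cardb: "card (set bs) = n"
      using Ys bs(1) card_length[of bs] card_mono[of "set bs" "set Ys"] by auto
    with \<open>card (set Ys) = n\<close> have eq: "set Ys = set bs"
      using Ys by (intro card_subset_eq) auto
    have "distinct bs" using bs(1) cardb by (simp add: card_distinct)
    then have "mset Ys = mset bs" using True eq by (simp add: set_eq_iff_mset_eq_distinct)
    then obtain p where "p permutes {..<length bs}" "permute_list p bs = Ys"
      by (rule mset_eq_permutation)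
    then show ?thesis
      using alternating_form_permute_eq_0[OF a L bs(1) bsL bs(3), of p] bs(1) by (simp add: permute_list_def)
  next
    case False
    then obtain i j where "i < n" "j < n" "i \<noteq> j" "Ys ! i = Ys ! j"
      using Ys(1) by (auto simp: distinct_conv_nth)
    then show ?thesis using Ys bsL by (intro alternating_form_eq_0[OF a, of Ys i j]) auto
  qed
  \<comment> \<open>Only the first \<open>m\<close> arguments are arbitrary; the case \<open>m = n\<close> is the claim.\<close>
  have "\<alpha> Xs = 0"
    if "length Xs = n" "set Xs \<subseteq> L" "m \<le> n" "\<And>i. m \<le> i \<Longrightarrow> i < n \<Longrightarrow> Xs ! i \<in> set bs" for m Xs
    using that
  proof (induction m arbitrary: Xs)
    case 0
    then show ?case by (intro basis) (auto simp: set_conv_nth)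
  next
    case (Suc m)
    have zero: "\<alpha> (Xs[m := x]) = 0" if "x \<in> set bs" for x
      using Suc.prems that bsL
      by (intro Suc.IH) (auto simp: nth_list_update dest!: set_update_subset_insert[THEN subsetD])
    have lin: "linear_on L (\<lambda>x. \<alpha> (Xs[m := x]))"
      using Suc.prems by (intro alternating_form_linear[OF a]) auto
    have "Xs ! m \<in> span (set bs)" using Suc.prems bs(2) by (auto simp: subset_iff)
    from linear_on_zero_span[OF lin L bsL zero this] have "\<alpha> (Xs[m := Xs ! m]) = 0" .
    then show ?case by simp
  qed
  from this[of _ n] show ?thesis by (auto simp: form_eq_def)
qed

lemma three_form_zero_of_span:
  assumes a: "alternating_form L 3 \<alpha>" and L: "subspace L" and F: "F \<subseteq> L" "span F = L"
    and 0: "\<And>x y z. \<lbrakk>x \<in> F; y \<in> F; z \<in> F\<rbrakk> \<Longrightarrow> \<alpha> [x, y, z] = 0"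
  shows "form_eq L 3 \<alpha> (\<lambda>_. 0)"
proof -
  have lin: "linear_on L (\<lambda>x. \<alpha> [x, y, z])" "linear_on L (\<lambda>x. \<alpha> [y, x, z])" "linear_on L (\<lambda>x. \<alpha> [y, z, x])"
    if "y \<in> L" "z \<in> L" for y z
    using alternating_form_linear[OF a, of "[y, y, z]" 0] alternating_form_linear[OF a, of "[y, y, z]" 1]
      alternating_form_linear[OF a, of "[y, z, z]" 2] that by simp_all
  have 1: "\<alpha> [x, y, z] = 0" if "x \<in> L" "y \<in> F" "z \<in> F" for x y z
    using that F by (intro linear_on_zero_span[OF lin(1) L F(1) 0]) auto
  have 2: "\<alpha> [x, y, z] = 0" if "x \<in> L" "y \<in> L" "z \<in> F" for x y z
    using that F by (intro linear_on_zero_span[OF lin(2) L F(1) 1]) auto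
  have "\<alpha> [x, y, z] = 0" if "x \<in> L" "y \<in> L" "z \<in> L" for x y z
    using that F by (intro linear_on_zero_span[OF lin(3) L F(1) 2]) auto
  then show ?thesis by (auto simp: form_eq_def numeral_3_eq_3 length_Suc_conv)
qed

lemma alternating_form_3_swap:
  assumes a: "alternating_form L 3 \<alpha>" and L: "subspace L" and "x \<in> L" "y \<in> L" "z \<in> L"
  shows "\<alpha> [y, x, z] = - \<alpha> [x, y, z]" "\<alpha> [x, z, y] = - \<alpha> [x, y, z]"
  using alternating_form_swap[OF a L, of "[x, y, z]" 0 1] alternating_form_swap[OF a L, of "[x, y, z]" 1 2] assms(3-)
  by simp_all

lemma alternating_form_3_repeat:
  assumes a: "alternating_form L 3 \<alpha>" and "x \<in> L" "z \<in> L"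
  shows "\<alpha> [x, x, z] = 0" "\<alpha> [x, z, z] = 0" "\<alpha> [x, z, x] = 0"
  using alternating_form_eq_0[OF a, of "[x, x, z]" 0 1] alternating_form_eq_0[OF a, of "[x, z, z]" 1 2]
    alternating_form_eq_0[OF a, of "[x, z, x]" 0 2] assms(2-)
  by simp_all

section \<open>Exterior derivatives and types in low degree\<close>

lemma ext_d_2: "ext_d br \<alpha> [a, b] = - \<alpha> [br a b]"
  by (simp add: ext_d_def lessThan_Suc nths_Cons eval_nat_numeral)

lemma ext_d_3: "ext_d br \<alpha> [a, b, c] = - \<alpha> [br a b, c] + \<alpha> [br a c, b] - \<alpha> [br b c, a]"
  by (simp add: ext_d_def lessThan_Suc nths_Cons eval_nat_numeral)

lemma ext_d_4: "ext_d br \<alpha> [a, b, c, d] = - \<alpha> [br a b, c, d] + \<alpha> [br a c, b, d] - \<alpha> [br a d, b, c]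
    - \<alpha> [br b c, a, d] + \<alpha> [br b d, a, c] - \<alpha> [br c d, a, b]"
  by (simp add: ext_d_def lessThan_Suc nths_Cons eval_nat_numeral)

lemma ext_d_5: "ext_d br \<alpha> [a, b, c, d, e] =
    - \<alpha> [br a b, c, d, e] + \<alpha> [br a c, b, d, e] - \<alpha> [br a d, b, c, e] + \<alpha> [br a e, b, c, d]
    - \<alpha> [br b c, a, d, e] + \<alpha> [br b d, a, c, e] - \<alpha> [br b e, a, c, d]
    - \<alpha> [br c d, a, b, e] + \<alpha> [br c e, a, b, d] - \<alpha> [br d e, a, b, c]"
  by (simp add: ext_d_def lessThan_Suc nths_Cons eval_nat_numeral)

text \<open>With this rule the sums over \<open>S\<close> and \<open>T\<close> in the definition of \<open>type_part\<close> expand by rewriting. In the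
resulting formulas, the coefficient of the term with \<open>J\<close> in the slots \<open>T\<close> is the sum over \<open>S\<close> of
\<open>(- \<i>) ^ card (T \<inter> S) * \<i> ^ card (T - S)\<close>, divided by \<open>2 ^ (p + q)\<close>.\<close>

lemma sum_Pow_insert:
  assumes "finite A" "a \<notin> A"
  shows "sum f (Pow (insert a A)) = sum f (Pow A) + (\<Sum>B\<in>Pow A. f (insert a B))"
proof -
  have "inj_on (insert a) (Pow A)" using assms(2) by (auto simp: inj_on_def)
  then show ?thesis using assms unfolding Pow_insert
    by (subst sum.union_disjoint) (auto simp: sum.reindex)
qed

lemma type_part_alt_def:
  "type_part J p q \<alpha> Xs =
     (\<Sum>S\<in>Pow {..<p + q}. if card S = p then \<Sum>T\<in>Pow {..<p + q}.
        (\<Prod>j\<in>T. if j \<in> S then - \<i> else \<i>) / 2 ^ (p + q)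
        * \<alpha> (map (\<lambda>j. if j \<in> T then J (Xs ! j) else Xs ! j) [0..<p + q]) else 0)"
  unfolding type_part_def by (subst sum.inter_filter[symmetric]) (auto simp: Pow_def)

lemma small_ranges:
  "{..<2::nat} = {0, 1}" "{..<3::nat} = {0, 1, 2}" "{..<4::nat} = {0, 1, 2, 3}"
  "[0..<2] = [0, 1::nat]" "[0..<3] = [0, 1, 2::nat]" "[0..<4] = [0, 1, 2, 3::nat]"
  by (auto simp: upt_rec)

lemma small_sums: "1 + 1 = (2::nat)" "1 + 2 = (3::nat)"
  by simp_all

lemma type_part_1_1: "type_part J 1 1 \<alpha> [a, b] = (\<alpha> [a, b] + \<alpha> [J a, J b]) / 2"
  unfolding type_part_alt_def small_sums
  by (simp add: small_ranges sum_Pow_insert field_simps)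

lemma type_part_3_0: "type_part J 3 0 \<alpha> [a, b, c] =
   (\<alpha> [a, b, c] - \<i> * \<alpha> [J a, b, c] - \<i> * \<alpha> [a, J b, c] - \<i> * \<alpha> [a, b, J c]
    - \<alpha> [J a, J b, c] - \<alpha> [J a, b, J c] - \<alpha> [a, J b, J c] + \<i> * \<alpha> [J a, J b, J c]) / 8"
  unfolding type_part_alt_def
  by (simp add: small_ranges sum_Pow_insert field_simps)

lemma type_part_1_2: "type_part J 1 2 \<alpha> [a, b, c] =
   (3 * \<alpha> [a, b, c] + \<i> * \<alpha> [J a, b, c] + \<i> * \<alpha> [a, J b, c] + \<i> * \<alpha> [a, b, J c]
    + \<alpha> [J a, J b, c] + \<alpha> [J a, b, J c] + \<alpha> [a, J b, J c] + 3 * \<i> * \<alpha> [J a, J b, J c]) / 8"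
  unfolding type_part_alt_def small_sums
  by (simp add: small_ranges sum_Pow_insert field_simps)

lemma type_part_3_1: "type_part J 3 1 \<alpha> [a, b, c, d] =
   (4 * \<alpha> [a, b, c, d]
    - 2 * \<i> * (\<alpha> [J a, b, c, d] + \<alpha> [a, J b, c, d] + \<alpha> [a, b, J c, d] + \<alpha> [a, b, c, J d])
    - 2 * \<i> * (\<alpha> [J a, J b, J c, d] + \<alpha> [J a, J b, c, J d] + \<alpha> [J a, b, J c, J d] + \<alpha> [a, J b, J c, J d])
    - 4 * \<alpha> [J a, J b, J c, J d]) / 16"
  unfolding type_part_alt_def
  by (simp add: small_ranges sum_Pow_insert) (simp add: field_simps)

lemma type_part_2_2: "type_part J 2 2 \<alpha> [a, b, c, d] =
   (6 * \<alpha> [a, b, c, d]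
    + 2 * (\<alpha> [J a, J b, c, d] + \<alpha> [J a, b, J c, d] + \<alpha> [J a, b, c, J d]
         + \<alpha> [a, J b, J c, d] + \<alpha> [a, J b, c, J d] + \<alpha> [a, b, J c, J d])
    + 6 * \<alpha> [J a, J b, J c, J d]) / 16"
  unfolding type_part_alt_def
  by (simp add: small_ranges sum_Pow_insert)

section \<open>Hermitian structures on a space with a bracket\<close>

text \<open>Closedness under the bracket is left to \<open>hermitian_lie_algebra\<close>: in the almost abelian case it is read off
from the normal form of the bracket, and that normal form needs the orthonormal frames built in this setting.\<close>

locale hermitian_algebra =
  fixes L :: "'v::real_vector set" and br :: "'v \<Rightarrow> 'v \<Rightarrow> 'v" and g :: "'v \<Rightarrow> 'v \<Rightarrow> real" and J :: "'v \<Rightarrow> 'v"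
  assumes subspace: "subspace L" and br_bilinear: "bilinear_on L br"
    and br_self: "x \<in> L \<Longrightarrow> br x x = 0"
    and hermitian: "hermitian_structure L br g J"
begin

lemma closed [simp]:
  "0 \<in> L" "x \<in> L \<Longrightarrow> y \<in> L \<Longrightarrow> x + y \<in> L" "x \<in> L \<Longrightarrow> y \<in> L \<Longrightarrow> x - y \<in> L"
  "x \<in> L \<Longrightarrow> r *\<^sub>R x \<in> L" "x \<in> L \<Longrightarrow> - x \<in> L"
  using subspace by (auto intro: subspace_0 subspace_add subspace_diff subspace_scale subspace_neg)

lemma br_add [simp]:
  "\<lbrakk>x \<in> L; y \<in> L; z \<in> L\<rbrakk> \<Longrightarrow> br (x + y) z = br x z + br y z"
  "\<lbrakk>x \<in> L; y \<in> L; z \<in> L\<rbrakk> \<Longrightarrow> br x (y + z) = br x y + br x z"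
  "\<lbrakk>x \<in> L; z \<in> L\<rbrakk> \<Longrightarrow> br (r *\<^sub>R x) z = r *\<^sub>R br x z"
  "\<lbrakk>x \<in> L; z \<in> L\<rbrakk> \<Longrightarrow> br x (r *\<^sub>R z) = r *\<^sub>R br x z"
  using br_bilinear by (auto simp: bilinear_on_def linear_on_def)

lemma br_minus [simp]:
  "\<lbrakk>x \<in> L; z \<in> L\<rbrakk> \<Longrightarrow> br (- x) z = - br x z"
  "\<lbrakk>x \<in> L; z \<in> L\<rbrakk> \<Longrightarrow> br x (- z) = - br x z"
  using br_add(3)[of x z "-1"] br_add(4)[of x z "-1"] by simp_all

lemma br_diff [simp]:
  "\<lbrakk>x \<in> L; y \<in> L; z \<in> L\<rbrakk> \<Longrightarrow> br (x - y) z = br x z - br y z"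
  "\<lbrakk>x \<in> L; y \<in> L; z \<in> L\<rbrakk> \<Longrightarrow> br x (y - z) = br x y - br x z"
  using br_add(1)[of x "- y" z] br_add(2)[of x y "- z"] by simp_all

lemma br_commute: "\<lbrakk>x \<in> L; y \<in> L\<rbrakk> \<Longrightarrow> br x y = - br y x"
proof -
  assume L: "x \<in> L" "y \<in> L"
  have "br x x + br y x + (br x y + br y y) = 0"
    using br_self[of "x + y"] L by (simp only: br_add closed)
  then show ?thesis using L by (simp add: br_self eq_neg_iff_add_eq_0 add.commute)
qed

lemma J_simps [simp]:
  "x \<in> L \<Longrightarrow> J x \<in> L" "x \<in> L \<Longrightarrow> J (J x) = - x"
  "\<lbrakk>x \<in> L; y \<in> L\<rbrakk> \<Longrightarrow> J (x + y) = J x + J y"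
  "x \<in> L \<Longrightarrow> J (r *\<^sub>R x) = r *\<^sub>R J x"
  using hermitian by (auto simp: hermitian_structure_def complex_structure_def linear_on_def)

lemma J_minus [simp]: "x \<in> L \<Longrightarrow> J (- x) = - J x"
  using J_simps(4)[of x "-1"] by simp

lemma J_diff [simp]: "\<lbrakk>x \<in> L; y \<in> L\<rbrakk> \<Longrightarrow> J (x - y) = J x - J y"
  using J_simps(3)[of x "- y"] by simp

lemma J_0 [simp]: "J 0 = 0"
  using J_simps(4)[of 0 0] by simp

lemma integrable:
  "\<lbrakk>x \<in> L; y \<in> L\<rbrakk> \<Longrightarrow> br (J x) (J y) - J (br (J x) y) - J (br x (J y)) - br x y = 0"
  using hermitian by (auto simp: hermitian_structure_def complex_structure_def)

lemma g_add [simp]: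
  "\<lbrakk>x \<in> L; y \<in> L; z \<in> L\<rbrakk> \<Longrightarrow> g (x + y) z = g x z + g y z"
  "\<lbrakk>x \<in> L; y \<in> L; z \<in> L\<rbrakk> \<Longrightarrow> g x (y + z) = g x y + g x z"
  "\<lbrakk>x \<in> L; z \<in> L\<rbrakk> \<Longrightarrow> g (r *\<^sub>R x) z = r * g x z"
  "\<lbrakk>x \<in> L; z \<in> L\<rbrakk> \<Longrightarrow> g x (r *\<^sub>R z) = r * g x z"
  using hermitian by (auto simp: hermitian_structure_def bilinear_on_def linear_on_def)

lemma g_minus [simp]:
  "\<lbrakk>x \<in> L; z \<in> L\<rbrakk> \<Longrightarrow> g (- x) z = - g x z"
  "\<lbrakk>x \<in> L; z \<in> L\<rbrakk> \<Longrightarrow> g x (- z) = - g x z"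
  using g_add(3)[of x z "-1"] g_add(4)[of x z "-1"] by simp_all

lemma g_diff [simp]:
  "\<lbrakk>x \<in> L; y \<in> L; z \<in> L\<rbrakk> \<Longrightarrow> g (x - y) z = g x z - g y z"
  "\<lbrakk>x \<in> L; y \<in> L; z \<in> L\<rbrakk> \<Longrightarrow> g x (y - z) = g x y - g x z"
  using g_add(1)[of x "- y" z] g_add(2)[of x y "- z"] by simp_all

lemma g_0 [simp]: "x \<in> L \<Longrightarrow> g 0 x = 0" "x \<in> L \<Longrightarrow> g x 0 = 0"
  using g_add(3)[of x x 0] g_add(4)[of x x 0] by simp_all

lemma g_sum:
  assumes "finite K" "\<And>k. k \<in> K \<Longrightarrow> f k \<in> L" "x \<in> L"
  shows "g (\<Sum>k\<in>K. f k) x = (\<Sum>k\<in>K. g (f k) x)" "g x (\<Sum>k\<in>K. f k) = (\<Sum>k\<in>K. g x (f k))"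
    "(\<Sum>k\<in>K. f k) \<in> L"
  using assms by (induction K) auto

lemma g_commute: "\<lbrakk>x \<in> L; y \<in> L\<rbrakk> \<Longrightarrow> g x y = g y x"
  using hermitian by (auto simp: hermitian_structure_def)

lemma g_pos: "\<lbrakk>x \<in> L; x \<noteq> 0\<rbrakk> \<Longrightarrow> g x x > 0"
  using hermitian by (auto simp: hermitian_structure_def)

lemma g_nonneg: "x \<in> L \<Longrightarrow> g x x \<ge> 0"
  using g_pos[of x] by (cases "x = 0") auto

lemma g_self_eq_0: "x \<in> L \<Longrightarrow> g x x = 0 \<longleftrightarrow> x = 0"
  using g_pos[of x] by (cases "x = 0") auto

lemma g_J [simp]: "\<lbrakk>x \<in> L; y \<in> L\<rbrakk> \<Longrightarrow> g (J x) (J y) = g x y"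
  using hermitian by (auto simp: hermitian_structure_def)

lemma g_J_left: "\<lbrakk>x \<in> L; y \<in> L\<rbrakk> \<Longrightarrow> g (J x) y = - g x (J y)"
  using g_J[of x "J y"] by simp

lemma g_J_self [simp]: "x \<in> L \<Longrightarrow> g x (J x) = 0" "x \<in> L \<Longrightarrow> g (J x) x = 0"
  using g_J_left[of x x] g_commute[of x "J x"] by simp_all

lemma vector_eqI:
  assumes "x \<in> L" "y \<in> L" "\<And>z. z \<in> L \<Longrightarrow> g x z = g y z"
  shows "x = y"
  using assms g_self_eq_0[of "x - y"] assms(3)[of "x - y"] by simp

abbreviation "\<omega> \<equiv> fundamental_form g J"

definition d\<omega> :: "'v \<Rightarrow> 'v \<Rightarrow> 'v \<Rightarrow> real" where
  "d\<omega> x y z = - g (J (br x y)) z + g (J (br x z)) y - g (J (br y z)) x"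

lemma ext_d_fundamental: "ext_d br \<omega> [x, y, z] = of_real (d\<omega> x y z)"
  by (simp add: ext_d_3 fundamental_form_def d\<omega>_def)

end

section \<open>Formulas for the Chern and Bismut connections\<close>

locale hermitian_lie_algebra = hermitian_algebra L br g J
  for L :: "'v::real_vector set" and br g J +
  assumes br_closed [simp]: "\<lbrakk>x \<in> L; y \<in> L\<rbrakk> \<Longrightarrow> br x y \<in> L"
begin

context
  fixes D assumes D: "hermitian_connection L g J D"
begin

lemma hc_closed [simp]: "\<lbrakk>x \<in> L; y \<in> L\<rbrakk> \<Longrightarrow> D x y \<in> L"
  using D by (auto simp: hermitian_connection_def)

lemma hc_skew: "\<lbrakk>x \<in> L; y \<in> L; z \<in> L\<rbrakk> \<Longrightarrow> g (D x y) z = - g (D x z) y"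
  using D g_commute[of y "D x z"] by (force simp: hermitian_connection_def)

lemma hc_J [simp]: "\<lbrakk>x \<in> L; y \<in> L\<rbrakk> \<Longrightarrow> D x (J y) = J (D x y)"
  using D by (auto simp: hermitian_connection_def)

lemma hc_linear [simp]:
  "\<lbrakk>x \<in> L; y \<in> L; z \<in> L\<rbrakk> \<Longrightarrow> D (x + y) z = D x z + D y z"
  "\<lbrakk>x \<in> L; y \<in> L; z \<in> L\<rbrakk> \<Longrightarrow> D x (y + z) = D x y + D x z"
  "\<lbrakk>x \<in> L; z \<in> L\<rbrakk> \<Longrightarrow> D (r *\<^sub>R x) z = r *\<^sub>R D x z"
  "\<lbrakk>x \<in> L; z \<in> L\<rbrakk> \<Longrightarrow> D x (r *\<^sub>R z) = r *\<^sub>R D x z"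
  using D by (auto simp: hermitian_connection_def bilinear_on_def linear_on_def)

lemma hc_minus [simp]:
  "\<lbrakk>x \<in> L; z \<in> L\<rbrakk> \<Longrightarrow> D (- x) z = - D x z"
  "\<lbrakk>x \<in> L; z \<in> L\<rbrakk> \<Longrightarrow> D x (- z) = - D x z"
  using hc_linear(3)[of x z "-1"] hc_linear(4)[of x z "-1"] by simp_all

lemma hc_diff [simp]:
  "\<lbrakk>x \<in> L; y \<in> L; z \<in> L\<rbrakk> \<Longrightarrow> D (x - y) z = D x z - D y z"
  "\<lbrakk>x \<in> L; y \<in> L; z \<in> L\<rbrakk> \<Longrightarrow> D x (y - z) = D x y - D x z"
  using hc_linear(1)[of x "- y" z] hc_linear(2)[of x y "- z"] by simp_all

lemma hc_0 [simp]: "x \<in> L \<Longrightarrow> D 0 x = 0" "x \<in> L \<Longrightarrow> D x 0 = 0"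
  using hc_linear(3)[of x x 0] hc_linear(4)[of x x 0] by simp_all

lemma hc_J_swap: "\<lbrakk>x \<in> L; y \<in> L; z \<in> L\<rbrakk> \<Longrightarrow> g (D x y) (J z) = g (D x z) (J y)"
  using hc_skew[of x y "J z"] g_J_left[of "D x z" y] by simp

text \<open>By metric compatibility, the trilinear form \<open>g(D\<^sub>x y, t)\<close> is given by the Koszul terms and the torsion
\<open>T\<close>, so \<open>T\<close> has to be found. Since \<open>\<omega>\<close> is parallel, \<open>d\<omega>\<close> is a cyclic sum of values of \<open>T\<close>; since \<open>J\<close>
is integrable and parallel, \<open>T\<close> satisfies an identity that collapses this sum at \<open>(J x, J y, J t)\<close>
to \<open>T(x, y, t)\<close>.\<close>

lemma bismut_formula:
  assumes skew: "\<And>x y z. \<lbrakk>x \<in> L; y \<in> L; z \<in> L\<rbrakk> \<Longrightarrow> g (torsion br D x y) z = - g (torsion br D x z) y"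
    and L: "x \<in> L" "y \<in> L" "z \<in> L"
  shows "2 * g (D x y) z = g (br x y) z - g (br y z) x + g (br z x) y + d\<omega> (J x) (J y) (J z)"
proof -
  define T where "T x y z = g (D x y) z - g (D y x) z - g (br x y) z" for x y z
  have T_tor: "T x y z = g (torsion br D x y) z" if "x \<in> L" "y \<in> L" "z \<in> L" for x y z
    using that by (simp add: T_def torsion_def)
  have T1: "T y x z = - T x y z" if "x \<in> L" "y \<in> L" "z \<in> L" for x y z
    using that br_commute[of y x] by (simp add: T_def)
  have T2: "T x z y = - T x y z" if "x \<in> L" "y \<in> L" "z \<in> L" for x y z
    using that skew[of x z y] by (simp add: T_tor)
  have dT: "d\<omega> x y z = - (T x y (J z) + T y z (J x) + T z x (J y))" if "x \<in> L" "y \<in> L" "z \<in> L" for x y z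
    using that hc_J_swap[of x y z] hc_J_swap[of y z x] hc_J_swap[of z x y] br_commute[of z x]
    by (simp add: T_def d\<omega>_def g_J_left)
  \<comment> \<open>The Nijenhuis tensor of \<open>J\<close> vanishes; written through \<open>D\<close>, only torsion terms remain.\<close>
  have "g (br (J x) (J y) - J (br (J x) y) - J (br x (J y)) - br x y) z = 0"
    using L by (simp only: integrable) simp
  then have "T x y z = T (J x) (J y) z + T (J x) y (J z) + T x (J y) (J z)"
    using L by (simp add: T_def g_J_left)
  also have "T (J x) y (J z) = T (J z) (J x) y"
    using L T1[of "J x" y "J z"] T2[of y "J z" "J x"] T1[of y "J z" "J x"] T2[of "J z" y "J x"] by simp
  also have "T x (J y) (J z) = T (J y) (J z) x"
    using L T1[of x "J y" "J z"] T2[of "J y" x "J z"] by simp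
  finally have "T x y z = d\<omega> (J x) (J y) (J z)"
    using L dT[of "J x" "J y" "J z"] by (simp add: T_def)
  moreover have "T y z x = T x y z" using L T1[of x y z] T2[of y x z] by simp
  moreover have "T z x y = T x y z" using L T1[of z x y] T2[of x z y] by simp
  ultimately show ?thesis
    using L hc_skew[of x y z] hc_skew[of y x z] hc_skew[of z x y] unfolding T_def by linarith
qed

text \<open>The condition on the torsion at \<open>(x, y)\<close> and at \<open>(J x, y)\<close> determines the operator
\<open>D\<^sub>x + J D\<^sub>J\<^sub>x\<close>, twice the \<open>(0,1)\<close>-part of \<open>D\<close>; it equals half of \<open>Q\<close>. The skew part of this
operator is \<open>D\<^sub>x\<close> because \<open>J D\<^sub>J\<^sub>x\<close> is symmetric.\<close>

lemma chern_formula: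
  assumes tor: "\<And>x y z. \<lbrakk>x \<in> L; y \<in> L; z \<in> L\<rbrakk> \<Longrightarrow> g (torsion br D x y) z + g (torsion br D (J x) (J y)) z = 0"
    and L: "x \<in> L" "y \<in> L" "z \<in> L"
  defines "Q \<equiv> \<lambda>x y. br x y + br (J x) (J y) + J (br (J x) y) - J (br x (J y))"
  shows "4 * g (D x y) z = g (Q x y) z - g (Q x z) y"
proof -
  have P: "2 * g (D x y) z - 2 * g (D (J x) y) (J z) = g (Q x y) z" if "x \<in> L" "y \<in> L" "z \<in> L" for x y z
    using that tor[of x y z] tor[of "J x" y "J z"] by (simp add: torsion_def Q_def g_J_left)
  show ?thesis
    using P[OF L] P[OF L(1) L(3) L(2)] hc_skew[of x z y] hc_J_swap[of "J x" z y] L by simp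
qed

end

end

context hermitian_algebra
begin

section \<open>Orthonormal frames\<close>

definition orthonormal :: "'v set \<Rightarrow> bool" where
  "orthonormal U \<longleftrightarrow> finite U \<and> U \<subseteq> L \<and> (\<forall>u\<in>U. \<forall>v\<in>U. g u v = (if u = v then 1 else 0))"

lemma orthonormal_insert:
  assumes "orthonormal U" "x \<in> L" "g x x = 1" "\<forall>u\<in>U. g x u = 0"
  shows "orthonormal (insert x U)" "x \<notin> U"
proof -
  have "g u x = 0" if "u \<in> U" for u
    using assms(1,2,4) that g_commute[of u x] by (auto simp: orthonormal_def)
  then show "orthonormal (insert x U)" using assms unfolding orthonormal_def by auto
  show "x \<notin> U" using assms(3,4) by auto
qed

lemma orthogonal_projection:
  assumes U: "orthonormal U" and x: "x \<in> L"
  defines "p \<equiv> x - (\<Sum>u\<in>U. g x u *\<^sub>R u)"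
  shows "p \<in> L" "\<And>u. u \<in> U \<Longrightarrow> g p u = 0" "x - p \<in> span U"
proof -
  have sum: "(\<Sum>u\<in>U. g x u *\<^sub>R u) \<in> L"
    using U x by (intro g_sum(3)[of _ _ x]) (auto simp: orthonormal_def)
  then show "p \<in> L" using x by (simp add: p_def)
  show "x - p \<in> span U" by (simp add: p_def span_sum span_scale span_base)
  fix u assume u: "u \<in> U"
  then have "u \<in> L" using U by (auto simp: orthonormal_def)
  then have "g (\<Sum>v\<in>U. g x v *\<^sub>R v) u = (\<Sum>v\<in>U. g x v * g v u)"
    using U by (subst g_sum(1)) (auto simp: orthonormal_def subset_iff intro!: sum.cong)
  also have "\<dots> = (\<Sum>v\<in>U. if v = u then g x v else 0)"
    using U u by (intro sum.cong) (auto simp: orthonormal_def)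
  also have "\<dots> = g x u" using U u by (simp add: orthonormal_def)
  finally show "g p u = 0" using x sum \<open>u \<in> L\<close> by (simp add: p_def)
qed

lemma orthonormal_independent:
  assumes U: "orthonormal U"
  shows "independent U"
proof
  assume "dependent U"
  then obtain c v where v: "v \<in> U" "c v \<noteq> 0" and 0: "(\<Sum>u\<in>U. c u *\<^sub>R u) = 0"
    using U by (auto simp: orthonormal_def dependent_finite)
  have "v \<in> L" using U v by (auto simp: orthonormal_def)
  then have "g (\<Sum>u\<in>U. c u *\<^sub>R u) v = (\<Sum>u\<in>U. c u * g u v)"
    using U by (subst g_sum(1)) (auto simp: orthonormal_def subset_iff intro!: sum.cong)
  also have "\<dots> = (\<Sum>u\<in>U. if u = v then c u else 0)"
    using U v by (intro sum.cong) (auto simp: orthonormal_def)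
  also have "\<dots> = c v" using U v by (simp add: orthonormal_def)
  finally show False using 0 v \<open>v \<in> L\<close> by simp
qed

text \<open>One Gram-Schmidt step: the component of \<open>x\<close> orthogonal to \<open>U\<close> is nonzero and is normalised.\<close>

lemma orthonormal_extend_within:
  assumes U: "orthonormal U" and V: "subspace V" "V \<subseteq> L" "U \<subseteq> V" and x: "x \<in> V" "x \<notin> span U"
  shows "\<exists>y\<in>V. g y y = 1 \<and> (\<forall>u\<in>U. g y u = 0)"
proof -
  define p where "p = x - (\<Sum>u\<in>U. g x u *\<^sub>R u)"
  note p = orthogonal_projection[OF U subsetD[OF V(2) x(1)], folded p_def]
  have "x - p \<in> V" using p(3) V span_minimal by blast
  then have "p \<in> V" using subspace_diff[OF V(1) x(1), of "x - p"] by simp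
  have "p \<noteq> 0" using p(3) x(2) by auto
  then have pos: "g p p > 0" using p(1) g_pos by simp
  let ?y = "(1 / sqrt (g p p)) *\<^sub>R p"
  have "g ?y ?y = g p p / (sqrt (g p p) * sqrt (g p p))" using p(1) by simp
  also have "\<dots> = 1" using pos by simp
  finally have "g ?y ?y = 1" .
  moreover have "g ?y u = 0" if "u \<in> U" for u using p(1) p(2)[OF that] that V by (simp add: subset_iff)
  ultimately show ?thesis using \<open>p \<in> V\<close> V(1) by (intro bexI[of _ ?y]) (auto intro: subspace_scale)
qed

end

locale hermitian_algebra_6 = hermitian_algebra L br g J
  for L :: "'v::real_vector set" and br g J +
  fixes e :: "nat \<Rightarrow> 'v"
  assumes frame: "orthonormal_frame L g 6 e"
begin

lemma e_closed [simp]: "i \<in> {1..6} \<Longrightarrow> e i \<in> L"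
  using frame by (auto simp: orthonormal_frame_def)

lemma e_span: "span (e ` {1..6}) = L"
  using frame by (auto simp: orthonormal_frame_def)

lemma e_orthonormal: "orthonormal (e ` {1..6})" and e_card: "card (e ` {1..6}) = 6"
  and e_inj: "inj_on e {1..6}"
proof -
  have *: "g (e i) (e j) = (if i = j then 1 else 0)" if "i \<in> {1..6}" "j \<in> {1..6}" for i j
    using frame that by (simp add: orthonormal_frame_def)
  have inj: "i = j" if "i \<in> {1..6}" "j \<in> {1..6}" "e i = e j" for i j
  proof (rule ccontr)
    assume "i \<noteq> j"
    then show False using *[OF that(1,2)] *[OF that(1,1)] that(3) by simp
  qed
  then show "inj_on e {1..6}" by (rule inj_onI)
  then show "card (e ` {1..6}) = 6" by (simp add: card_image)
  have "g (e i) (e j) = (if e i = e j then 1 else 0)" if "i \<in> {1..6}" "j \<in> {1..6}" for i j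
    using *[OF that] inj[OF that] by auto
  then show "orthonormal (e ` {1..6})"
    unfolding orthonormal_def by (simp add: image_subset_iff)
qed

lemma orthonormal_card_le: "orthonormal U \<Longrightarrow> card U \<le> 6"
proof -
  assume U: "orthonormal U"
  then have "U \<subseteq> span (e ` {1..6})" unfolding e_span orthonormal_def by simp
  then have "card U \<le> card (e ` {1..6})"
    using independent_span_bound[OF _ orthonormal_independent[OF U], of "e ` {1..6}"] by simp
  then show ?thesis by (simp only: e_card)
qed

lemma orthonormal_extend:
  assumes U: "orthonormal U" and "card U < 6"
  shows "\<exists>y\<in>L. g y y = 1 \<and> (\<forall>u\<in>U. g y u = 0)"
proof -
  have "\<not> e ` {1..6} \<subseteq> span U"
    using independent_span_bound[OF _ orthonormal_independent[OF e_orthonormal], of U] U assms(2) e_card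
    by (auto simp: orthonormal_def)
  then obtain x where "x \<in> e ` {1..6}" "x \<notin> span U" by blast
  then have x: "x \<in> L" "x \<notin> span U" by auto
  have "U \<subseteq> L" using U by (simp add: orthonormal_def)
  from orthonormal_extend_within[OF U subspace order_refl this x] show ?thesis .
qed

lemma orthonormal_expand:
  assumes U: "orthonormal U" and card: "card U = 6" and x: "x \<in> L"
  shows "x = (\<Sum>u\<in>U. g x u *\<^sub>R u)"
proof (rule ccontr)
  define p where "p = x - (\<Sum>u\<in>U. g x u *\<^sub>R u)"
  note p = orthogonal_projection[OF U x, folded p_def]
  assume "x \<noteq> (\<Sum>u\<in>U. g x u *\<^sub>R u)"
  then have "p \<noteq> 0" by (simp add: p_def)
  have "p \<notin> span U"
  proof
    assume "p \<in> span U"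
    have "U \<subseteq> L" using U by (simp add: orthonormal_def)
    have "g p p = 0"
    proof (rule linear_on_zero_span[OF _ subspace \<open>U \<subseteq> L\<close> p(2) \<open>p \<in> span U\<close>])
      show "linear_on L (g p)" using p(1) by (simp add: linear_on_def)
    qed
    then show False using g_self_eq_0[OF p(1)] \<open>p \<noteq> 0\<close> by simp
  qed
  have "U \<subseteq> L" using U by (simp add: orthonormal_def)
  from orthonormal_extend_within[OF U subspace order_refl this p(1) \<open>p \<notin> span U\<close>]
  obtain y where y: "y \<in> L" "g y y = 1" "\<forall>u\<in>U. g y u = 0" by blast
  have "finite U" using U by (simp add: orthonormal_def)
  then have "card (insert y U) = 7" using orthonormal_insert(2)[OF U y] card by simp
  then show False using orthonormal_card_le[OF orthonormal_insert(1)[OF U y]] by simp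
qed

lemma e_expand: "x \<in> L \<Longrightarrow> x = (\<Sum>k\<in>{1..6}. g x (e k) *\<^sub>R e k)"
proof -
  assume "x \<in> L"
  have "(\<Sum>u\<in>e ` {1..6}. g x u *\<^sub>R u) = (\<Sum>k\<in>{1..6}. g x (e k) *\<^sub>R e k)"
    using sum.reindex[OF e_inj, of "\<lambda>u. g x u *\<^sub>R u"] by (simp only: o_def)
  with orthonormal_expand[OF e_orthonormal e_card \<open>x \<in> L\<close>] show ?thesis by (rule trans)
qed

text \<open>An orthonormal subset of \<open>I\<close> of maximal size spans \<open>I\<close> and hence has five elements. It extends by one
vector \<open>z\<close>, and together with \<open>z\<close> it is a frame of \<open>L\<close>, so that vectors orthogonal to \<open>z\<close> lie in \<open>I\<close>.\<close>

lemma unit_normal_exists: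
  assumes I: "subspace I" "I \<subseteq> L" "dim L = dim I + 1"
  shows "\<exists>z\<in>L. g z z = 1 \<and> (\<forall>x\<in>I. g z x = 0) \<and> (\<forall>x\<in>L. g z x = 0 \<longrightarrow> x \<in> I)"
proof -
  have "dim L = 6"
    using dim_eq_card_independent[OF orthonormal_independent[OF e_orthonormal]] dim_span[of "e ` {1..6}"]
    by (simp only: e_span e_card)
  then have dimI: "dim I = 5" using I(3) by simp
  define K where "K = card ` {U. orthonormal U \<and> U \<subseteq> I}"
  have "orthonormal {}" by (simp add: orthonormal_def)
  then have "0 \<in> K" by (auto simp: K_def intro!: image_eqI[of _ _ "{}"])
  moreover have "finite K"
    using orthonormal_card_le by (intro finite_subset[of K "{..6}"]) (auto simp: K_def)
  ultimately have "Max K \<in> K" by (intro Max_in) auto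
  then obtain U where U: "orthonormal U" "U \<subseteq> I" "card U = Max K" by (auto simp: K_def)
  have "I \<subseteq> span U"
  proof (rule ccontr)
    assume "\<not> I \<subseteq> span U"
    then obtain x where "x \<in> I" "x \<notin> span U" by blast
    from orthonormal_extend_within[OF U(1) I(1,2) U(2) this]
    obtain y where y: "y \<in> I" "g y y = 1" "\<forall>u\<in>U. g y u = 0" by blast
    have "y \<in> L" using y(1) I(2) by auto
    note ins = orthonormal_insert[OF U(1) this y(2,3)]
    have "card (insert y U) \<in> K" using ins(1) U(2) y(1) by (auto simp: K_def)
    then have "card (insert y U) \<le> card U" using \<open>finite K\<close> U(3) by simp
    then show False using ins(2) U(1) by (simp add: orthonormal_def)
  qed
  moreover have "span U \<subseteq> I" using U(2) I(1) by (simp add: span_minimal)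
  ultimately have spanU: "span U = I" by blast
  then have cardU: "card U = 5"
    using dim_eq_card_independent[OF orthonormal_independent[OF U(1)]] dim_span[of U] dimI by simp
  obtain z where z: "z \<in> L" "g z z = 1" "\<forall>u\<in>U. g z u = 0"
    using orthonormal_extend[OF U(1)] cardU by auto
  have "U \<subseteq> L" using U(1) by (simp add: orthonormal_def)
  have "g z x = 0" if "x \<in> I" for x
  proof (rule linear_on_zero_span[OF _ subspace \<open>U \<subseteq> L\<close>])
    show "linear_on L (g z)" using z(1) by (simp add: linear_on_def)
  qed (use z(3) spanU that in auto)
  moreover have "x \<in> I" if x: "x \<in> L" "g z x = 0" for x
  proof -
    note ins = orthonormal_insert[OF U(1) z]
    have "card (insert z U) = 6" using ins(2) cardU U(1) by (simp add: orthonormal_def)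
    note expand = orthonormal_expand[OF ins(1) this x(1)]
    have "(\<Sum>u\<in>insert z U. g x u *\<^sub>R u) = (\<Sum>u\<in>U. g x u *\<^sub>R u)"
      using ins(2) U(1) x z(1) g_commute[of x z] by (simp add: orthonormal_def)
    with expand have "x = (\<Sum>u\<in>U. g x u *\<^sub>R u)" by (rule trans)
    then show "x \<in> I" using spanU by (metis (no_types, lifting) span_base span_scale span_sum)
  qed
  ultimately show ?thesis using z by blast
qed

end

section \<open>Unitary triples and the powers of the fundamental form\<close>

context hermitian_algebra
begin

lemma alternating_fundamental: "alternating_form L 2 \<omega>"
proof -
  have "alternating_form L 2 (\<lambda>Xs. complex_of_real ((\<lambda>x y. g (J x) y) (Xs ! 0) (Xs ! 1)))"
    by (rule alternating_two_form) (auto simp: bilinear_on_def linear_on_def)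
  then show ?thesis by (simp add: fundamental_form_def[abs_def])
qed

lemma fundamental_square:
  assumes "a \<in> L" "b \<in> L" "c \<in> L" "d \<in> L"
  shows "form_square \<omega> [a, b, c, d] =
    2 * complex_of_real (g (J a) b * g (J c) d - g (J a) c * g (J b) d + g (J a) d * g (J b) c)"
  unfolding form_square_def wedge_2_2[OF alternating_fundamental alternating_fundamental subspace assms]
  by (simp add: fundamental_form_def algebra_simps)

lemma alternating_fundamental_square: "alternating_form L 4 (form_square \<omega>)"
  using alternating_wedge[OF alternating_fundamental alternating_fundamental] by (simp add: form_square_def)

text \<open>A unitary basis: the six vectors \<open>u\<close>, \<open>J u\<close>, \<open>v\<close>, \<open>J v\<close>, \<open>w\<close>, \<open>J w\<close> are orthonormal. The relations that
follow from these by \<open>J\<close>-invariance of \<open>g\<close> are collected in \<open>unitary_tripleD\<close>.\<close>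

definition unitary_triple :: "'v \<Rightarrow> 'v \<Rightarrow> 'v \<Rightarrow> bool" where
  "unitary_triple u v w \<longleftrightarrow> u \<in> L \<and> v \<in> L \<and> w \<in> L \<and> g u u = 1 \<and> g v v = 1 \<and> g w w = 1 \<and>
     g u v = 0 \<and> g u (J v) = 0 \<and> g u w = 0 \<and> g u (J w) = 0 \<and> g v w = 0 \<and> g v (J w) = 0"

lemma unitary_tripleD:
  assumes "unitary_triple u v w"
  shows "u \<in> L" "v \<in> L" "w \<in> L" "g u u = 1" "g v v = 1" "g w w = 1"
    "g u v = 0" "g u (J v) = 0" "g u w = 0" "g u (J w) = 0" "g v w = 0" "g v (J w) = 0"
    "g v u = 0" "g v (J u) = 0" "g w u = 0" "g w (J u) = 0" "g w v = 0" "g w (J v) = 0"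
    "g (J u) v = 0" "g (J u) w = 0" "g (J v) w = 0" "g (J v) u = 0" "g (J w) u = 0" "g (J w) v = 0"
  using assms g_commute[of u v] g_commute[of u w] g_commute[of v w]
    g_commute[of u "J v"] g_commute[of u "J w"] g_commute[of v "J w"]
    g_J_left[of u v] g_J_left[of u w] g_J_left[of v w]  g_J_left[of v u] g_J_left[of w u] g_J_left[of w v]
  unfolding unitary_triple_def by auto

text \<open>Wedging a two-form with \<open>\<omega>\<^sup>2\<close> contracts it with \<open>\<omega>\<close>. Only shuffles that keep the pairs
\<open>(u, J u)\<close>, \<open>(v, J v)\<close>, \<open>(w, J w)\<close> together contribute, since \<open>\<omega>\<^sup>2\<close> vanishes on all other four vectors of
the frame.\<close>

lemma fundamental_square_wedge:
  assumes u: "unitary_triple u v w" and \<alpha>: "alternating_form L 2 \<alpha>"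
  shows "wedge 4 2 (form_square \<omega>) \<alpha> [u, J u, v, J v, w, J w] = 2 * (\<alpha> [u, J u] + \<alpha> [v, J v] + \<alpha> [w, J w])"
  using unitary_tripleD[OF u]
  by (subst wedge_eq_shuffle_sum[OF alternating_fundamental_square \<alpha> subspace])
     (simp_all add: fundamental_square algebra_simps)

lemma fundamental_cube:
  assumes u: "unitary_triple u v w"
  shows "form_cube \<omega> [u, J u, v, J v, w, J w] = 6"
  unfolding form_cube_def fundamental_square_wedge[OF u alternating_fundamental]
  using unitary_tripleD[OF u] by (simp add: fundamental_form_def)

end

context hermitian_algebra_6
begin

lemma unitary_triple_expand:
  assumes u: "unitary_triple u v w" and x: "x \<in> L"
  shows "x = g x u *\<^sub>R u + g x (J u) *\<^sub>R J u + g x v *\<^sub>R v + g x (J v) *\<^sub>R J v + g x w *\<^sub>R w + g x (J w) *\<^sub>R J w"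
proof -
  note U = unitary_tripleD[OF u]
  have neq: "distinct [u, J u, v, J v, w, J w]"
    using U g_J_self[of u] g_J_self[of v] g_J_self[of w] g_J[of u u] g_J[of v v] g_J[of w w]
      g_J[of u v] g_J[of u w] g_J[of v w] by (auto simp del: g_J_self g_J)
  have "orthonormal (set [u, J u, v, J v, w, J w])"
    using U neq by (auto simp: orthonormal_def)
  from orthonormal_expand[OF this _ x] distinct_card[OF neq]
  have "x = (\<Sum>b\<in>set [u, J u, v, J v, w, J w]. g x b *\<^sub>R b)" by simp
  also have "\<dots> = (\<Sum>b\<leftarrow>[u, J u, v, J v, w, J w]. g x b *\<^sub>R b)"
    by (rule sum_list_distinct_conv_sum_set[OF neq, symmetric])
  finally show ?thesis by (rule trans) (simp add: add.assoc)
qed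

lemma unitary_triple_span:
  assumes u: "unitary_triple u v w"
  shows "span (set [u, J u, v, J v, w, J w]) = L"
proof
  note U = unitary_tripleD[OF u]
  show "span (set [u, J u, v, J v, w, J w]) \<subseteq> L" using U subspace by (intro span_minimal) auto
  show "L \<subseteq> span (set [u, J u, v, J v, w, J w])"
  proof
    fix x assume "x \<in> L"
    have "g x u *\<^sub>R u + g x (J u) *\<^sub>R J u + g x v *\<^sub>R v + g x (J v) *\<^sub>R J v + g x w *\<^sub>R w + g x (J w) *\<^sub>R J w
        \<in> span (set [u, J u, v, J v, w, J w])"
      by (intro span_add span_scale span_base) simp_all
    from iffD2[OF arg_cong[OF unitary_triple_expand[OF u \<open>x \<in> L\<close>], of "\<lambda>y. y \<in> span (set [u, J u, v, J v, w, J w])"] this]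
    show "x \<in> span (set [u, J u, v, J v, w, J w])" .
  qed
qed

lemma unitary_triple_exists:
  assumes u: "u \<in> L" "g u u = 1"
  shows "\<exists>v w. unitary_triple u v w"
proof -
  have Ju: "J u \<noteq> u" using g_J_self[of u] u by (metis zero_neq_one)
  have "orthonormal {u, J u}" using u Ju by (auto simp: orthonormal_def)
  moreover have "card {u, J u} < 6" using Ju by simp
  ultimately obtain v where v: "v \<in> L" "g v v = 1" "g v u = 0" "g v (J u) = 0"
    using orthonormal_extend[of "{u, J u}"] by auto
  have v': "g u v = 0" "g (J u) v = 0" "g u (J v) = 0" "g (J v) u = 0"
    using u v g_commute[of u v] g_commute[of "J u" v] g_J_left[of u v] g_J_left[of v u] by auto
  have ne: "v \<noteq> u" "v \<noteq> J u" "J v \<noteq> u" "J v \<noteq> J u" "J v \<noteq> v"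
    using u v v' g_J[of v u] g_J_self[of v] g_J[of v v] by (auto simp del: g_J g_J_self)
  have "orthonormal {u, J u, v, J v}" using u v v' Ju ne by (auto simp: orthonormal_def)
  moreover have "card {u, J u, v, J v} < 6" using card_length[of "[u, J u, v, J v]"] by simp
  ultimately obtain w where w: "w \<in> L" "g w w = 1" "g w u = 0" "g w (J u) = 0" "g w v = 0" "g w (J v) = 0"
    using orthonormal_extend[of "{u, J u, v, J v}"] by auto
  have "g u w = 0" "g v w = 0" "g u (J w) = 0" "g v (J w) = 0"
    using u v w g_commute[of u w] g_commute[of v w] g_commute[of u "J w"] g_commute[of v "J w"]
      g_J_left[of w u] g_J_left[of w v] by auto
  then have "unitary_triple u v w" using u v v' w unfolding unitary_triple_def by simp
  then show ?thesis by blast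
qed

section \<open>The norm of a holomorphic volume form\<close>

context
  fixes \<Psi> :: "'v form" assumes \<Psi>: "holomorphic_volume_form L br J \<Psi>"
begin

lemma Psi_alternating: "alternating_form L 3 \<Psi>"
  using \<Psi> by (simp add: holomorphic_volume_form_def)

lemmas Psi_swap = alternating_form_3_swap[OF Psi_alternating subspace]
lemmas Psi_repeat = alternating_form_3_repeat[OF Psi_alternating]

lemma Psi_linear:
  assumes "x \<in> L" "y \<in> L"
  shows "linear_on L (\<lambda>z. \<Psi> [z, x, y])" "linear_on L (\<lambda>z. \<Psi> [x, z, y])" "linear_on L (\<lambda>z. \<Psi> [x, y, z])"
  using alternating_form_linear[OF Psi_alternating, of "[x, x, y]" 0]
    alternating_form_linear[OF Psi_alternating, of "[x, y, y]" 1]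
    alternating_form_linear[OF Psi_alternating, of "[x, y, y]" 2] assms by simp_all

lemma Psi_linear_simps:
  assumes "x \<in> L" "y \<in> L" "z \<in> L" "w \<in> L"
  shows "\<Psi> [z + w, x, y] = \<Psi> [z, x, y] + \<Psi> [w, x, y]" "\<Psi> [r *\<^sub>R z, x, y] = of_real r * \<Psi> [z, x, y]"
    "\<Psi> [x, z + w, y] = \<Psi> [x, z, y] + \<Psi> [x, w, y]" "\<Psi> [x, r *\<^sub>R z, y] = of_real r * \<Psi> [x, z, y]"
    "\<Psi> [x, y, z + w] = \<Psi> [x, y, z] + \<Psi> [x, y, w]" "\<Psi> [x, y, r *\<^sub>R z] = of_real r * \<Psi> [x, y, z]"
  using Psi_linear[OF assms(1,2)] assms(3,4) unfolding linear_on_def scaleR_conv_of_real[symmetric] by blast+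

lemma Psi_minus:
  assumes "x \<in> L" "y \<in> L" "z \<in> L"
  shows "\<Psi> [- z, x, y] = - \<Psi> [z, x, y]" "\<Psi> [x, - z, y] = - \<Psi> [x, z, y]" "\<Psi> [x, y, - z] = - \<Psi> [x, y, z]"
  using Psi_linear_simps(2)[OF assms assms(3), of "-1"] Psi_linear_simps(4)[OF assms assms(3), of "-1"]
    Psi_linear_simps(6)[OF assms assms(3), of "-1"] by (simp_all only: scaleR_minus1_left of_real_minus of_real_1 mult_minus1)

text \<open>A form of type \<open>(3,0)\<close> is complex linear: it equals its own complex multilinear extension evaluated on
the vectors \<open>(X - \<i> J X)/2\<close>, and applying \<open>J\<close> to \<open>X\<close> multiplies these by \<open>\<i>\<close>.\<close>

lemma Psi_J:
  assumes L: "x \<in> L" "y \<in> L" "z \<in> L"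
  shows "\<Psi> [J x, y, z] = \<i> * \<Psi> [x, y, z]" "\<Psi> [x, J y, z] = \<i> * \<Psi> [x, y, z]" "\<Psi> [x, y, J z] = \<i> * \<Psi> [x, y, z]"
proof -
  have eq: "\<Psi> [x, y, z] = type_part J 3 0 \<Psi> [x, y, z]" if "x \<in> L" "y \<in> L" "z \<in> L" for x y z
    using \<Psi> that by (simp add: holomorphic_volume_form_def has_type_def form_eq_def)
  have 1: "\<Psi> [J x, y, z] = \<i> * \<Psi> [x, y, z]" if "x \<in> L" "y \<in> L" "z \<in> L" for x y z
    using that by (subst (1 2) eq) (simp_all add: type_part_3_0 Psi_minus field_simps)
  show "\<Psi> [J x, y, z] = \<i> * \<Psi> [x, y, z]" using 1[OF L] .
  show "\<Psi> [x, J y, z] = \<i> * \<Psi> [x, y, z]" "\<Psi> [x, y, J z] = \<i> * \<Psi> [x, y, z]"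
    using L Psi_swap(1)[of x "J y" z] Psi_swap(1)[of x y z] Psi_swap(2)[of x y "J z"] Psi_swap(2)[of x y z]
      1[of y x z] Psi_swap(1)[of x "J z" y] Psi_swap(1)[of x z y] 1[of z x y] by simp_all
qed

text \<open>By complex linearity and antisymmetry all values of \<open>\<Psi>\<close> on the frame are multiples of this one, which
therefore cannot be zero.\<close>

lemma Psi_nonzero:
  assumes u: "unitary_triple u v w"
  shows "\<Psi> [u, v, w] \<noteq> 0"
proof
  note U = unitary_tripleD(1-3)[OF u]
  assume 0: "\<Psi> [u, v, w] = 0"
  have p: "\<Psi> [v, u, w] = 0" "\<Psi> [u, w, v] = 0" using U 0 Psi_swap(1,2)[of u v w] by simp_all
  have p': "\<Psi> [v, w, u] = 0" "\<Psi> [w, u, v] = 0" using U p Psi_swap(2)[of v u w] Psi_swap(1)[of u w v] by simp_all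
  have p'': "\<Psi> [w, v, u] = 0" using U p' Psi_swap(1)[of v w u] by simp
  have base: "\<Psi> [x, y, z] = 0" if "x \<in> {u, v, w}" "y \<in> {u, v, w}" "z \<in> {u, v, w}" for x y z
    using that by (elim insertE emptyE) (simp_all add: 0 p p' p'' U Psi_repeat)
  have "\<Psi> [x, y, z] = 0"
    if "x \<in> set [u, J u, v, J v, w, J w]" "y \<in> set [u, J u, v, J v, w, J w]" "z \<in> set [u, J u, v, J v, w, J w]" for x y z
  proof -
    have *: "\<exists>x'\<in>{u, v, w}. x = x' \<or> x = J x'" if "x \<in> set [u, J u, v, J v, w, J w]" for x
      using that by auto
    from *[OF that(1)] *[OF that(2)] *[OF that(3)] obtain x' y' z' where
      "x' \<in> {u, v, w}" "y' \<in> {u, v, w}" "z' \<in> {u, v, w}" "x = x' \<or> x = J x'" "y = y' \<or> y = J y'" "z = z' \<or> z = J z'"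
      by blast
    moreover from this(1-3) have "x' \<in> L" "y' \<in> L" "z' \<in> L" using U by auto
    ultimately show ?thesis using base[of x' y' z'] by (auto simp: Psi_J)
  qed
  then have "form_eq L 3 \<Psi> (\<lambda>_. 0)"
    using U by (intro three_form_zero_of_span[OF Psi_alternating subspace _ unitary_triple_span[OF u]]) auto
  then show False using \<Psi> by (simp add: holomorphic_volume_form_def)
qed

lemma cnj_Psi_alternating: "alternating_form L 3 (\<lambda>Ys. cnj (\<Psi> Ys))"
proof (rule alternating_formI)
  fix Xs i assume "length Xs = 3" "set Xs \<subseteq> L" "i < (3::nat)"
  then show "linear_on L (\<lambda>x. cnj (\<Psi> (Xs[i := x])))"
    using alternating_form_linear[OF Psi_alternating, of Xs i] by (simp add: linear_on_def scaleR_conv_of_real)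
next
  fix Xs i j assume "length Xs = 3" "set Xs \<subseteq> L" "i < (3::nat)" "j < 3" "i \<noteq> j" "Xs ! i = Xs ! j"
  then show "cnj (\<Psi> Xs) = 0"
    using alternating_form_eq_0[OF Psi_alternating, of Xs i j] by simp
qed

text \<open>A shuffle contributes only if each factor receives one vector of every pair; there are eight of these,
and replacing \<open>u\<close> by \<open>J u\<close> in one factor and \<open>J u\<close> by \<open>u\<close> in the other changes both the value and the
sign of the shuffle, so all contributions agree.\<close>

lemma Psi_wedge_conj:
  assumes u: "unitary_triple u v w"
  shows "\<i> * wedge 3 3 \<Psi> (\<lambda>Ys. cnj (\<Psi> Ys)) [u, J u, v, J v, w, J w] = complex_of_real (8 * (cmod (\<Psi> [u, v, w]))\<^sup>2)"
proof -
  note U = unitary_tripleD(1-3)[OF u]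
  have "wedge 3 3 \<Psi> (\<lambda>Ys. cnj (\<Psi> Ys)) [u, J u, v, J v, w, J w] = - 8 * \<i> * (\<Psi> [u, v, w] * cnj (\<Psi> [u, v, w]))"
    using U by (subst wedge_eq_shuffle_sum[OF Psi_alternating cnj_Psi_alternating subspace])
      (simp_all add: Psi_J Psi_repeat)
  then show ?thesis unfolding of_real_mult complex_norm_square by simp
qed

end
end

context hermitian_algebra_6
begin

text \<open>The number that defines the norm exists because both sides are forms of top degree whose values on a
frame are known, and their ratio is positive. By positivity the conformally balanced equation is
equivalent to \<open>d(\<omega>\<^sup>2) = 0\<close>.\<close>

lemma volume_norm_pos:
  assumes \<Psi>: "holomorphic_volume_form L br J \<Psi>"
  shows "volume_norm L \<omega> \<Psi> > 0"
proof -
  have "e 1 \<in> L" "g (e 1) (e 1) = 1" using frame by (auto simp: orthonormal_frame_def)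
  then obtain v w where u: "unitary_triple (e 1) v w" using unitary_triple_exists by blast
  note U = unitary_tripleD(1-3)[OF u]
  let ?bs = "[e 1, J (e 1), v, J v, w, J w]"
  let ?R = "\<lambda>Xs. \<i> * wedge 3 3 \<Psi> (\<lambda>Ys. cnj (\<Psi> Ys)) Xs"
  define c where "c = sqrt (8 * (cmod (\<Psi> [e 1, v, w]))\<^sup>2)"
  have cpos: "c > 0" using Psi_nonzero[OF \<Psi> u] by (simp add: c_def)
  have c2: "c\<^sup>2 = 8 * (cmod (\<Psi> [e 1, v, w]))\<^sup>2" by (simp add: c_def)
  have R: "?R ?bs = complex_of_real (c\<^sup>2)" by (simp only: Psi_wedge_conj[OF \<Psi> u] c2)
  have alt: "alternating_form L 6 (form_cube \<omega>)" "alternating_form L 6 (wedge 3 3 \<Psi> (\<lambda>Ys. cnj (\<Psi> Ys)))"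
    using alternating_wedge[OF alternating_fundamental_square alternating_fundamental]
      alternating_wedge[OF Psi_alternating[OF \<Psi>] cnj_Psi_alternating[OF \<Psi>]]
    by (simp_all add: form_cube_def)
  have "form_eq L 6 (\<lambda>Xs. complex_of_real (c\<^sup>2) / fact 3 * form_cube \<omega> Xs + (- \<i>) * wedge 3 3 \<Psi> (\<lambda>Ys. cnj (\<Psi> Ys)) Xs) (\<lambda>_. 0)"
  proof (rule top_form_eq_0[OF alternating_form_lincomb[OF alt] subspace, of ?bs])
    show "complex_of_real (c\<^sup>2) / fact 3 * form_cube \<omega> ?bs + - \<i> * wedge 3 3 \<Psi> (\<lambda>Ys. cnj (\<Psi> Ys)) ?bs = 0"
      using R fundamental_cube[OF u] by (simp add: fact_numeral)
  qed (use unitary_triple_span[OF u] in simp_all)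
  then have ex: "form_eq L 6 (\<lambda>Xs. complex_of_real (c\<^sup>2) * form_cube \<omega> Xs / fact 3) ?R"
    by (simp add: form_eq_def)
  have "volume_norm L \<omega> \<Psi> = c"
    unfolding volume_norm_def
  proof (rule the_equality)
    show "0 \<le> c \<and> form_eq L 6 (\<lambda>Xs. complex_of_real (c\<^sup>2) * form_cube \<omega> Xs / fact 3) ?R"
      using ex cpos by simp
    fix d assume d: "0 \<le> d \<and> form_eq L 6 (\<lambda>Xs. complex_of_real (d\<^sup>2) * form_cube \<omega> Xs / fact 3) ?R"
    then have "complex_of_real (d\<^sup>2) * form_cube \<omega> ?bs / fact 3 = ?R ?bs"
      using U unfolding form_eq_def by (elim conjE allE[of _ ?bs]) auto
    then have "complex_of_real (d\<^sup>2) = complex_of_real (c\<^sup>2)"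
      unfolding R fundamental_cube[OF u] by (simp add: fact_numeral)
    then have "d\<^sup>2 = c\<^sup>2" by (simp only: of_real_eq_iff)
    then show "d = c" using d cpos by simp
  qed
  then show ?thesis using cpos by simp
qed

lemma balanced_of_conformally_balanced:
  assumes \<Psi>: "holomorphic_volume_form L br J \<Psi>"
    and "form_eq L 5 (ext_d br (\<lambda>Xs. complex_of_real (volume_norm L \<omega> \<Psi>) * form_square \<omega> Xs)) (\<lambda>_. 0)"
  shows "form_eq L 5 (ext_d br (form_square \<omega>)) (\<lambda>_. 0)"
proof -
  have "ext_d br (\<lambda>Xs. c * \<alpha> Xs) Xs = c * ext_d br \<alpha> Xs" for c :: complex and \<alpha> :: "'v form" and Xs
    by (simp add: ext_d_def sum_distrib_left mult_ac)
  then show ?thesis using assms(2) volume_norm_pos[OF \<Psi>] by (simp add: form_eq_def)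
qed

end

section \<open>Almost abelian Hermitian algebras\<close>

text \<open>Here \<open>z\<close> is a unit normal of the abelian ideal, which is the kernel of \<open>g z\<close>; the bracket is determined
by the operator \<open>br z\<close>.\<close>

locale almost_abelian_hermitian = hermitian_algebra_6 L br g J e
  for L :: "'v::real_vector set" and br g J e +
  fixes z :: 'v
  assumes z_closed [simp]: "z \<in> L" and z_unit [simp]: "g z z = 1"
    and br_z_closed [simp]: "x \<in> L \<Longrightarrow> br z x \<in> L"
    and br_eq: "\<lbrakk>x \<in> L; y \<in> L\<rbrakk> \<Longrightarrow> br x y = g z x *\<^sub>R br z y - g z y *\<^sub>R br z x"
    and g_z_br [simp]: "x \<in> L \<Longrightarrow> g z (br z x) = 0"
begin

sublocale hermitian_lie_algebra
proof
  show "br x y \<in> L" if "x \<in> L" "y \<in> L" for x y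
    unfolding br_eq[OF that] using that by simp
qed

abbreviation (input) A where "A x \<equiv> br z x"

lemma br_z_z [simp]: "br z z = 0"
  by (simp add: br_self)

lemma br_ideal: "\<lbrakk>x \<in> L; y \<in> L; g z x = 0; g z y = 0\<rbrakk> \<Longrightarrow> br x y = 0"
  using br_eq[of x y] by simp

lemma br_ideal_z: "\<lbrakk>x \<in> L; g z x = 0\<rbrakk> \<Longrightarrow> br x z = - A x"
  using br_eq[of x z] by simp

text \<open>The largest complex subspace of the ideal, that is, the orthogonal complement of \<open>z\<close> and \<open>J z\<close>.\<close>

definition N :: "'v set" where
  "N = {x \<in> L. g z x = 0 \<and> g z (J x) = 0}"

lemma N_D: "x \<in> N \<Longrightarrow> x \<in> L" "x \<in> N \<Longrightarrow> g z x = 0" "x \<in> N \<Longrightarrow> g z (J x) = 0"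
  by (auto simp: N_def)

lemma N_J: "x \<in> N \<Longrightarrow> J x \<in> N"
  by (auto simp: N_def)

text \<open>The Nijenhuis tensor at \<open>(z, x)\<close> reduces to \<open>- J (A (J x)) - A x\<close>, as \<open>J z\<close>, \<open>x\<close> and \<open>J x\<close> lie in the
abelian ideal.\<close>

lemma A_J_N: "x \<in> N \<Longrightarrow> A (J x) = J (A x)"
proof -
  assume x: "x \<in> N"
  note x = N_D[OF x]
  have "br (J z) (J x) = 0" "br (J z) x = 0" using x by (simp_all add: br_ideal)
  then have "- J (A (J x)) - A x = 0"
    using integrable[of z x] x by simp
  then have "J (- J (A (J x))) = J (A x)" by simp
  then show ?thesis using x by simp
qed

lemma A_N:
  assumes x: "x \<in> N"
  shows "A x \<in> N"
proof -
  have "g z (J (A x)) = g z (A (J x))" using A_J_N[OF x] by simp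
  then show ?thesis using N_D(1)[OF x] N_D(1)[OF N_J[OF x]] by (simp add: N_def)
qed

lemma unitary_triple_N:
  assumes u: "unitary_triple z u v"
  shows "u \<in> N" "v \<in> N"
  using unitary_tripleD[OF u] by (simp_all add: N_def)

lemma N_J_z:
  assumes x: "x \<in> N"
  shows "g (J z) x = 0" "g x z = 0" "g x (J z) = 0"
proof -
  show 1: "g (J z) x = 0" using N_D[OF x] by (simp add: g_J_left)
  show "g x z = 0" using N_D[OF x] by (simp add: g_commute[of x z])
  show "g x (J z) = 0" using N_D[OF x] 1 by (simp add: g_commute[of x "J z"])
qed

context
  assumes balanced: "form_eq L 5 (ext_d br (form_square \<omega>)) (\<lambda>_. 0)"
begin

text \<open>On \<open>z\<close> and four vectors of the ideal only the brackets with \<open>z\<close> survive in the Koszul formula.\<close>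

lemma balanced_5:
  assumes "x1 \<in> L" "x2 \<in> L" "x3 \<in> L" "x4 \<in> L" "g z x1 = 0" "g z x2 = 0" "g z x3 = 0" "g z x4 = 0"
  shows "- form_square \<omega> [A x1, x2, x3, x4] + form_square \<omega> [A x2, x1, x3, x4]
    - form_square \<omega> [A x3, x1, x2, x4] + form_square \<omega> [A x4, x1, x2, x3] = 0"
proof -
  have 0: "form_square \<omega> [0, a, b, c] = 0" if "a \<in> L" "b \<in> L" "c \<in> L" for a b c
    using that by (simp add: fundamental_square)
  have br0: "br x1 x2 = 0" "br x1 x3 = 0" "br x1 x4 = 0" "br x2 x3 = 0" "br x2 x4 = 0" "br x3 x4 = 0"
    using assms by (simp_all add: br_ideal)
  have "ext_d br (form_square \<omega>) [z, x1, x2, x3, x4] = 0"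
    using balanced assms by (simp add: form_eq_def)
  then show ?thesis
    unfolding ext_d_5 br0 by (simp only: 0 assms z_closed diff_0_right add_0_right)
qed

text \<open>The value of \<open>d(\<omega>\<^sup>2)\<close> on \<open>(z, u, J u, v, J v)\<close> is a multiple of the trace of \<open>A\<close> on \<open>N\<close>. This trace is
twice the sum below because \<open>A\<close> commutes with \<open>J\<close> on \<open>N\<close>.\<close>

lemma balanced_trace:
  assumes u: "unitary_triple z u v"
  shows "g (A u) u + g (A v) v = 0"
proof -
  note U = unitary_tripleD[OF u]
  note uN = unitary_triple_N[OF u]
  show ?thesis
    using balanced_5[of u "J u" v "J v"] U uN
    by (simp add: A_J_N fundamental_square g_J_left algebra_simps)
qed

lemma fundamental_square_N:
  assumes "a \<in> N" "c \<in> N" "d \<in> N"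
  shows "form_square \<omega> [a, J z, c, d] = 0"
  using N_D(1)[OF assms(1)] N_D(1,2)[OF assms(2)] N_D(1,2)[OF assms(3)] N_J_z(2)[OF assms(1)]
  by (simp add: fundamental_square)

text \<open>The value of \<open>d(\<omega>\<^sup>2)\<close> on \<open>(z, J z, u, J u, x)\<close>: in all terms but the one with \<open>A (J z)\<close>, the vector
\<open>J z\<close> meets three vectors of \<open>N\<close>, to which it is \<open>\<omega>\<close>-orthogonal.\<close>

lemma balanced_A_Jz_normal:
  assumes u: "unitary_triple z u v" and x: "x = v \<or> x = J v"
  shows "g (A (J z)) (J x) = 0"
proof -
  note U = unitary_tripleD[OF u]
  note uN = unitary_triple_N[OF u]
  have xN: "x \<in> N" and ux: "g u x = 0" "g u (J x) = 0" "g x u = 0" "g (J u) x = 0"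
    using x uN(2) N_J[OF uN(2)] U by auto
  have "form_square \<omega> [A (J z), u, J u, x] = of_real (- 2 * g (A (J z)) (J x))"
    using U(2,5) ux N_D(1)[OF xN] by (simp add: fundamental_square g_J_left)
  moreover have "form_square \<omega> [A u, J z, J u, x] = 0" "form_square \<omega> [A (J u), J z, u, x] = 0"
    "form_square \<omega> [A x, J z, u, J u] = 0"
    using uN(1) xN A_N N_J by (simp_all add: fundamental_square_N)
  moreover have "- form_square \<omega> [A (J z), u, J u, x] + form_square \<omega> [A u, J z, J u, x]
    - form_square \<omega> [A (J u), J z, u, x] + form_square \<omega> [A x, J z, u, J u] = 0"
    using uN(1) xN N_J[OF uN(1)] by (intro balanced_5) (simp_all add: N_D)
  ultimately show ?thesis by simp
qed

lemma balanced_A_Jz: "A (J z) = g (A (J z)) (J z) *\<^sub>R J z"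
proof -
  obtain u v where u: "unitary_triple z u v" using unitary_triple_exists[of z] by auto
  note U = unitary_tripleD[OF u]
  have u': "unitary_triple z v u" using U by (simp add: unitary_triple_def)
  have "g (A (J z)) u = 0" "g (A (J z)) (J u) = 0" "g (A (J z)) v = 0" "g (A (J z)) (J v) = 0"
    using balanced_A_Jz_normal[OF u, of v] balanced_A_Jz_normal[OF u, of "J v"]
      balanced_A_Jz_normal[OF u', of u] balanced_A_Jz_normal[OF u', of "J u"] U by simp_all
  moreover have "g (A (J z)) z = 0" using g_z_br[of "J z"] g_commute[of z "A (J z)"] by simp
  ultimately show ?thesis
    by - (rule trans[OF unitary_triple_expand[OF u]], simp, simp)
qed

text \<open>On \<open>(z, J z, u, v)\<close> the form \<open>d\<Psi>\<close> equals, up to the factor \<open>- \<i>\<close>, the product of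
\<open>\<Psi>(z, u, v)\<close> with \<open>a\<close> plus the complex trace of \<open>A\<close> on \<open>N\<close>. The real part of that trace is the sum in
\<open>balanced_trace\<close>, which vanishes.\<close>

lemma A_Jz_eq_0_of_holomorphic:
  assumes \<Psi>: "holomorphic_volume_form L br J \<Psi>"
  shows "A (J z) = 0"
proof -
  obtain u v where u: "unitary_triple z u v" using unitary_triple_exists[of z] by auto
  note U = unitary_tripleD[OF u]
  note uN = unitary_triple_N[OF u]
  define a where "a = g (A (J z)) (J z)"
  have Aa: "A (J z) = a *\<^sub>R J z" using balanced_A_Jz by (simp add: a_def)
  define P where "P = \<Psi> [z, u, v]"
  define K where "K x y = - \<Psi> [A (J z), x, y] + \<Psi> [A x, J z, y] - \<Psi> [A y, J z, x]" for x y
  note J = Psi_J[OF \<Psi>] and M = Psi_minus[OF \<Psi>]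
  have AN: "A u \<in> N" "A v \<in> N" using A_N uN by auto
  have d: "ext_d br \<Psi> [z, J z, x, y] = K x y" "ext_d br \<Psi> [J z, J z, x, y] = 0"
    "ext_d br \<Psi> [z, - z, x, y] = 0" "ext_d br \<Psi> [J z, - z, x, y] = K x y" if "x \<in> N" "y \<in> N" for x y
    using N_D[OF that(1)] N_D[OF that(2)] Psi_linear_simps(2)[OF \<Psi>, of _ _ _ _ 0]
    by (simp_all add: ext_d_4 K_def br_ideal br_ideal_z br_self M)
  \<comment> \<open>So \<open>d\<Psi>\<close> is complex linear in the last two slots. Together with the values in the first two
    slots, this makes its \<open>(3,1)\<close>-component at \<open>(z, J z, u, v)\<close> equal to its value there.\<close>
  have K: "K (J u) v = \<i> * K u v" "K u (J v) = \<i> * K u v" "K (J u) (J v) = - K u v"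
    using uN AN by (simp_all add: K_def A_J_N N_D J algebra_simps)
  have "type_part J 3 1 (ext_d br \<Psi>) [z, J z, u, v] = 0"
    using \<Psi> U by (simp add: holomorphic_volume_form_def form_eq_def delbar_def)
  then have K0: "K u v = 0"
    unfolding type_part_3_1 using uN by (simp add: d K N_J)
  have exp: "A x = g (A x) u *\<^sub>R u + g (A x) (J u) *\<^sub>R J u + (g (A x) v *\<^sub>R v + g (A x) (J v) *\<^sub>R J v)"
    if "A x \<in> N" for x
    using N_J_z[OF that]
    by - (rule trans[OF unitary_triple_expand[OF u N_D(1)[OF that]]], simp add: add.assoc)
  note sw = Psi_swap[OF \<Psi>] and rep = Psi_repeat[OF \<Psi>] and lin = Psi_linear_simps[OF \<Psi>]
  have Au: "\<Psi> [A u, J z, v] = - \<i> * (of_real (g (A u) u) + \<i> * of_real (g (A u) (J u))) * P"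
  proof -
    have "\<Psi> [A u, J z, v] = \<Psi> [g (A u) u *\<^sub>R u + g (A u) (J u) *\<^sub>R J u + (g (A u) v *\<^sub>R v + g (A u) (J v) *\<^sub>R J v), J z, v]"
      using exp[OF AN(1)] by (rule arg_cong)
    also have "\<dots> = - \<i> * (of_real (g (A u) u) + \<i> * of_real (g (A u) (J u))) * P"
      using U sw(1)[of z u v] rep(3)[of v z] by (simp add: lin J P_def algebra_simps)
    finally show ?thesis .
  qed
  have Av: "\<Psi> [A v, J z, u] = \<i> * (of_real (g (A v) v) + \<i> * of_real (g (A v) (J v))) * P"
  proof -
    have "\<Psi> [A v, J z, u] = \<Psi> [g (A v) u *\<^sub>R u + g (A v) (J u) *\<^sub>R J u + (g (A v) v *\<^sub>R v + g (A v) (J v) *\<^sub>R J v), J z, u]"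
      using exp[OF AN(2)] by (rule arg_cong)
    also have "\<dots> = \<i> * (of_real (g (A v) v) + \<i> * of_real (g (A v) (J v))) * P"
      using U sw(1)[of z v u] sw(2)[of z u v] rep(3)[of u z] by (simp add: lin J P_def algebra_simps)
    finally show ?thesis .
  qed
  have "K u v = - \<i> * (of_real (a + (g (A u) u + g (A v) v)) + \<i> * of_real (g (A u) (J u) + g (A v) (J v))) * P"
    using U by (simp add: K_def Au Av Aa lin J P_def[symmetric]) (simp add: algebra_simps)
  then have "of_real a + \<i> * of_real (g (A u) (J u) + g (A v) (J v)) = 0"
    using K0 Psi_nonzero[OF \<Psi> u] balanced_trace[OF u] by (simp add: P_def)
  then have "a = 0" by (simp add: complex_eq_iff)
  then show ?thesis using Aa by simp
qed

end

end

section \<open>Curvature in an orthonormal frame\<close>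

context hermitian_lie_algebra
begin

lemma hermitian_connection_combination:
  assumes D1: "hermitian_connection L g J D1" and D2: "hermitian_connection L g J D2"
    and D: "\<And>x y. \<lbrakk>x \<in> L; y \<in> L\<rbrakk> \<Longrightarrow> D x y = a *\<^sub>R D1 x y + b *\<^sub>R D2 x y"
  shows "hermitian_connection L g J D"
  unfolding hermitian_connection_def bilinear_on_def linear_on_def
proof (intro conjI ballI allI)
  fix x y t assume L: "x \<in> L" "y \<in> L" "t \<in> L"
  have c: "D1 x y \<in> L" "D2 x y \<in> L" "D1 x t \<in> L" "D2 x t \<in> L"
    using L D1 D2 by (simp_all add: hc_closed)
  have "g y (D1 x t) = - g (D1 x y) t" "g y (D2 x t) = - g (D2 x y) t"
    using L c hc_skew[OF D1, of x y t] hc_skew[OF D2, of x y t] g_commute[of y "D1 x t"] g_commute[of y "D2 x t"]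
    by simp_all
  then show "g (D x y) t + g y (D x t) = 0" using L c by (simp add: D)
qed (use D1 D2 in \<open>simp_all add: D algebra_simps\<close>)

lemma chern_torsion:
  assumes D: "chern_connection L br g J D" and L: "x \<in> L" "y \<in> L" "t \<in> L"
  shows "g (torsion br D x y) t + g (torsion br D (J x) (J y)) t = 0"
proof -
  have "type_part J 1 1 (\<lambda>Xs. complex_of_real (g (torsion br D (Xs ! 0) (Xs ! 1)) t)) [x, y] = 0"
    using D L by (simp add: chern_connection_def form_eq_def del: One_nat_def)
  then have "complex_of_real (g (torsion br D x y) t + g (torsion br D (J x) (J y)) t) = 0"
    unfolding type_part_1_1 by simp
  then show ?thesis by (simp only: of_real_eq_0_iff)
qed

definition curv :: "('v \<Rightarrow> 'v \<Rightarrow> 'v) \<Rightarrow> 'v \<Rightarrow> 'v \<Rightarrow> 'v \<Rightarrow> 'v" where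
  "curv D x y v = D x (D y v) - D y (D x v) - D (br x y) v"

end

locale hermitian_lie_algebra_6 = hermitian_lie_algebra L br g J + hermitian_algebra_6 L br g J e
  for L :: "'v::real_vector set" and br g J e
begin

lemma parseval:
  assumes "x \<in> L" "y \<in> L"
  shows "g x y = (\<Sum>k\<in>{1..6}. g x (e k) * g y (e k))"
proof -
  have "g x y = g (\<Sum>k\<in>{1..6}. g x (e k) *\<^sub>R e k) y"
    using e_expand[OF assms(1)] by (rule arg_cong)
  also have "\<dots> = (\<Sum>k\<in>{1..6}. g (g x (e k) *\<^sub>R e k) y)"
    using assms by (intro g_sum) auto
  also have "\<dots> = (\<Sum>k\<in>{1..6}. g x (e k) * g y (e k))"
    using assms by (intro sum.cong refl) (simp add: g_commute[of y])
  finally show ?thesis .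
qed

context
  fixes D assumes D: "hermitian_connection L g J D"
begin

lemma conn_form_alternating:
  assumes "i \<in> {1..6}" "j \<in> {1..6}"
  shows "alternating_form L 1 (conn_form g e D i j)"
proof (rule alternating_formI)
  fix Xs k assume "length Xs = 1" "set Xs \<subseteq> L" "k < (1::nat)"
  then show "linear_on L (\<lambda>x. conn_form g e D i j (Xs[k := x]))"
    using assms D e_closed by (simp add: linear_on_def conn_form_def scaleR_conv_of_real)
qed auto

text \<open>The product of the connection matrices is the composition of the operators \<open>D x\<close> and \<open>D y\<close>: skewness of
\<open>D x\<close> moves it to the frame vector \<open>e i\<close>, where Parseval's identity applies.\<close>

lemma frame_contraction:
  assumes "x \<in> L" "v \<in> L" "i \<in> {1..6}"
  shows "(\<Sum>k\<in>{1..6}. g (D x (e k)) (e i) * g v (e k)) = g (D x v) (e i)"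
proof -
  have ei: "e i \<in> L" using assms by simp
  have "g (D x v) (e i) = - g (D x (e i)) v" using hc_skew[OF D assms(1,2) ei] .
  also have "\<dots> = (\<Sum>k\<in>{1..6}. - (g (D x (e i)) (e k) * g v (e k)))"
    using parseval[of "D x (e i)" v] assms ei D by (simp add: sum_negf)
  also have "\<dots> = (\<Sum>k\<in>{1..6}. g (D x (e k)) (e i) * g v (e k))"
    using assms ei by (intro sum.cong refl) (simp add: hc_skew[OF D _ ei])
  finally show ?thesis ..
qed

lemma curv_form_eq:
  assumes ij: "i \<in> {1..6}" "j \<in> {1..6}" and L: "x \<in> L" "y \<in> L"
  shows "curv_form br g e D i j [x, y] = complex_of_real (g (curv D x y (e j)) (e i))"
proof -
  have e: "e i \<in> L" "e j \<in> L" using ij by auto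
  have "wedge 1 1 (conn_form g e D i k) (conn_form g e D k j) [x, y]
      = complex_of_real (g (D x (e k)) (e i) * g (D y (e j)) (e k) - g (D y (e k)) (e i) * g (D x (e j)) (e k))"
    if "k \<in> {1..6}" for k
    using that ij L by (subst wedge_eq_shuffle_sum[OF conn_form_alternating conn_form_alternating subspace])
      (simp_all add: conn_form_def)
  then have "(\<Sum>k\<in>{1..6}. wedge 1 1 (conn_form g e D i k) (conn_form g e D k j) [x, y])
      = complex_of_real (\<Sum>k\<in>{1..6}. g (D x (e k)) (e i) * g (D y (e j)) (e k) - g (D y (e k)) (e i) * g (D x (e j)) (e k))"
    by (simp del: One_nat_def)
  also have "\<dots> = complex_of_real (g (D x (D y (e j))) (e i) - g (D y (D x (e j))) (e i))"
    unfolding sum_subtractf using frame_contraction[OF L(1) _ ij(1)] frame_contraction[OF L(2) _ ij(1)] L e D by simp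
  finally show ?thesis
    using L e D by (simp add: curv_form_def ext_d_2 conn_form_def curv_def)
qed

lemma curv_simps:
  assumes "x \<in> L" "y \<in> L" "v \<in> L" "w \<in> L"
  shows "curv D x y v \<in> L" "curv D (x + w) y v = curv D x y v + curv D w y v"
    "curv D x (y + w) v = curv D x y v + curv D x w v"
    "curv D (r *\<^sub>R x) y v = r *\<^sub>R curv D x y v" "curv D x (r *\<^sub>R y) v = r *\<^sub>R curv D x y v"
    "curv D x x v = 0" "curv D x y (v + w) = curv D x y v + curv D x y w"
    "curv D x y (r *\<^sub>R v) = r *\<^sub>R curv D x y v"
  using assms D by (simp_all add: curv_def br_self algebra_simps)

lemma curv_form_alternating:
  assumes ij: "i \<in> {1..6}" "j \<in> {1..6}"
  shows "alternating_form L 2 (curv_form br g e D i j)"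
proof (rule alternating_form_cong[OF subspace])
  have e: "e i \<in> L" "e j \<in> L" using ij by auto
  show "alternating_form L 2 (\<lambda>Xs. complex_of_real ((\<lambda>x y. g (curv D x y (e j)) (e i)) (Xs ! 0) (Xs ! 1)))"
  proof (rule alternating_two_form)
    show "bilinear_on L (\<lambda>x y. g (curv D x y (e j)) (e i))"
      using e by (simp add: bilinear_on_def linear_on_def curv_simps(1) curv_simps(2)[OF _ _ e(2)]
          curv_simps(3)[OF _ _ e(2)] curv_simps(4)[OF _ _ e(2) e(2)] curv_simps(5)[OF _ _ e(2) e(2)])
    show "g (curv D x x (e j)) (e i) = 0" if "x \<in> L" for x
      using e that curv_simps(6)[OF that that e(2) e(2)] by simp
  qed
  show "form_eq L 2 (curv_form br g e D i j)
     (\<lambda>Xs. complex_of_real ((\<lambda>x y. g (curv D x y (e j)) (e i)) (Xs ! 0) (Xs ! 1)))"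
    using curv_form_eq[OF ij] by (auto simp: form_eq_def numeral_2_eq_2 length_Suc_conv)
qed

text \<open>The condition is imposed on the entries of the curvature in the frame \<open>e\<close>, but the contraction is taken in
a unitary triple; it is bilinear in \<open>p\<close> and \<open>q\<close>, so it vanishes for all of them.\<close>

lemma instanton_trace:
  assumes inst: "instanton L br g J e D" and u: "unitary_triple u v w" and pq: "p \<in> L" "q \<in> L"
  shows "g (curv D u (J u) p) q + g (curv D v (J v) p) q + g (curv D w (J w) p) q = 0"
proof -
  note U = unitary_tripleD(1-3)[OF u]
  define H where "H p q = g (curv D u (J u) p) q + g (curv D v (J v) p) q + g (curv D w (J w) p) q" for p q
  have H: "H (e j) (e i) = 0" if ij: "i \<in> {1..6}" "j \<in> {1..6}" for i j
  proof -
    have "wedge 4 2 (form_square \<omega>) (curv_form br g e D i j) [u, J u, v, J v, w, J w] = 0"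
      using inst ij U by (simp add: instanton_def form_eq_def)
    then have "complex_of_real (2 * H (e j) (e i)) = 0"
      unfolding fundamental_square_wedge[OF u curv_form_alternating[OF ij]] using U
      by (simp add: curv_form_eq[OF ij] H_def)
    then show ?thesis unfolding of_real_eq_0_iff by simp
  qed
  have "e ` {1..6} \<subseteq> L" by auto
  have 1: "H p q = 0" if "p \<in> L" "q \<in> e ` {1..6}" for p q
  proof (rule linear_on_zero_span[OF _ subspace \<open>e ` {1..6} \<subseteq> L\<close>, of "\<lambda>p. H p q"])
    have "q \<in> L" using that by auto
    then show "linear_on L (\<lambda>p. H p q)"
      using U curv_simps(7,8)[of u "J u"] curv_simps(7,8)[of v "J v"] curv_simps(7,8)[of w "J w"]
        curv_simps(1)[of u "J u"] curv_simps(1)[of v "J v"] curv_simps(1)[of w "J w"]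
      by (simp add: linear_on_def H_def algebra_simps)
  qed (use that H e_span in auto)
  have "H p q = 0"
  proof (rule linear_on_zero_span[OF _ subspace \<open>e ` {1..6} \<subseteq> L\<close>, of "H p"])
    show "linear_on L (H p)"
      using U pq curv_simps(1)[of u "J u" p] curv_simps(1)[of v "J v" p] curv_simps(1)[of w "J w" p]
      by (simp add: linear_on_def H_def algebra_simps)
  qed (use pq 1 e_span in auto)
  then show ?thesis by (simp add: H_def)
qed

end

end

section \<open>Balanced almost abelian algebras\<close>

locale almost_abelian_balanced = almost_abelian_hermitian L br g J e z
  for L :: "'v::real_vector set" and br g J e z +
  assumes A_Jz [simp]: "br z (J z) = 0"
begin

sublocale hermitian_lie_algebra_6 ..

text \<open>Both sides vanish on the complex line through \<open>z\<close>, so the claim follows from its case on \<open>N\<close>.\<close>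

lemma A_J [simp]:
  assumes x: "x \<in> L"
  shows "A (J x) = J (A x)"
proof -
  define n where "n = x - g z x *\<^sub>R z - g (J z) x *\<^sub>R J z"
  have "n \<in> N" using x by (simp add: n_def N_def g_J_left[of z x])
  then have "A (J n) = J (A n)" by (rule A_J_N)
  then show ?thesis using x by (simp add: n_def)
qed

lemma g_z_J_A [simp]: "x \<in> L \<Longrightarrow> g z (J (A x)) = 0"
  using g_z_br[of "J x"] by simp

lemma A_in_N: "x \<in> L \<Longrightarrow> A x \<in> N"
  by (simp add: N_def)

text \<open>Twice the symmetric part of \<open>A\<close>, as a bilinear form.\<close>

definition s :: "'v \<Rightarrow> 'v \<Rightarrow> real" where
  "s x y = g (A x) y + g x (A y)"

lemma s_commute: "\<lbrakk>x \<in> L; y \<in> L\<rbrakk> \<Longrightarrow> s x y = s y x"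
  using g_commute[of "A x" y] g_commute[of x "A y"] by (simp add: s_def)

lemma s_J [simp]: "\<lbrakk>x \<in> L; y \<in> L\<rbrakk> \<Longrightarrow> s (J x) (J y) = s x y"
  by (simp add: s_def)

lemma s_linear [simp]:
  "\<lbrakk>x \<in> L; y \<in> L; t \<in> L\<rbrakk> \<Longrightarrow> s (x + y) t = s x t + s y t"
  "\<lbrakk>x \<in> L; y \<in> L; t \<in> L\<rbrakk> \<Longrightarrow> s t (x + y) = s t x + s t y"
  "\<lbrakk>x \<in> L; t \<in> L\<rbrakk> \<Longrightarrow> s (r *\<^sub>R x) t = r * s x t"
  "\<lbrakk>x \<in> L; t \<in> L\<rbrakk> \<Longrightarrow> s t (r *\<^sub>R x) = r * s t x"
  by (simp_all add: s_def algebra_simps)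

lemma s_minus [simp]:
  "\<lbrakk>x \<in> L; t \<in> L\<rbrakk> \<Longrightarrow> s (- x) t = - s x t" "\<lbrakk>x \<in> L; t \<in> L\<rbrakk> \<Longrightarrow> s t (- x) = - s t x"
  using s_linear(3)[of x t "-1"] s_linear(4)[of x t "-1"] by simp_all

lemma s_J_left: "\<lbrakk>x \<in> L; y \<in> L\<rbrakk> \<Longrightarrow> s (J x) y = - s x (J y)"
  using s_J[of "J x" y] by simp

lemma s_z [simp]: "y \<in> L \<Longrightarrow> s z y = 0" "y \<in> L \<Longrightarrow> s (J z) y = 0"
  by (simp_all add: s_def g_J_left)

lemma d\<omega>_eq:
  assumes L: "x \<in> L" "y \<in> L" "t \<in> L"
  shows "d\<omega> x y t = - g z x * s (J y) t + g z y * s (J x) t - g z t * s (J x) y"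
  unfolding d\<omega>_def br_eq[OF L(1,2)] br_eq[OF L(1,3)] br_eq[OF L(2,3)]
  using L g_commute[of "A t" "J x"] g_commute[of "A y" "J x"] g_commute[of "A t" "J y"]
  by (simp add: s_def g_J_left algebra_simps)

lemma kaehler_of_s_eq_0:
  assumes "\<And>x y. \<lbrakk>x \<in> L; y \<in> L\<rbrakk> \<Longrightarrow> s x y = 0"
  shows "kaehler L br g J"
  using assms by (auto simp: kaehler_def form_eq_def numeral_3_eq_3 length_Suc_conv ext_d_fundamental d\<omega>_eq)

section \<open>The Gauduchon connections of a balanced almost abelian algebra\<close>

text \<open>In the formula for the Bismut connection the torsion term vanishes, since \<open>z\<close> and \<open>J z\<close> lie in
the kernel of \<open>s\<close> and are orthogonal; what is left is the Levi-Civita connection.\<close>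

lemma bismut_z:
  assumes D: "bismut_connection L br g J D" and L: "x \<in> L" "t \<in> L"
  shows "g (D x z) t = - s x t / 2"
proof -
  have "2 * g (D x z) t = g (br x z) t - g (br z t) x + g (br t x) z + d\<omega> (J x) (J z) (J t)"
  proof (rule bismut_formula)
    show "hermitian_connection L g J D" using D by (simp add: bismut_connection_def)
    show "g (torsion br D x y) t = - g (torsion br D x t) y" if "x \<in> L" "y \<in> L" "t \<in> L" for x y t
      using D that unfolding bismut_connection_def by blast
  qed (use L in auto)
  also have "\<dots> = - s x t"
    unfolding br_eq[OF L(1) z_closed] br_eq[OF L(2,1)] using L g_commute[of "A x" z] g_commute[of "A t" z] g_commute[of x "A t"]
      g_commute[of "A x" "J z"] g_commute[of "A t" "J z"]
    by (simp add: d\<omega>_eq s_def g_J_left[of z])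
  finally show ?thesis by simp
qed

lemma chern_eq:
  assumes D: "chern_connection L br g J D" and L: "x \<in> L" "y \<in> L" "t \<in> L"
  shows "2 * g (D x y) t = g z x * (g (A y) t - g (A t) y) + g z (J x) * (g (J (A y)) t - g (J (A t)) y)"
proof -
  define Q where "Q x y = br x y + br (J x) (J y) + J (br (J x) y) - J (br x (J y))" for x y
  have Q: "Q x y = (g z x *\<^sub>R A y + g z (J x) *\<^sub>R J (A y)) + (g z x *\<^sub>R A y + g z (J x) *\<^sub>R J (A y))" if "x \<in> L" "y \<in> L" for x y
    unfolding Q_def br_eq[OF that] br_eq[OF J_simps(1)[OF that(1)] J_simps(1)[OF that(2)]]
      br_eq[OF J_simps(1)[OF that(1)] that(2)] br_eq[OF that(1) J_simps(1)[OF that(2)]]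
    using that by (simp add: algebra_simps)
  have "4 * g (D x y) t = g (Q x y) t - g (Q x t) y"
    unfolding Q_def using D L
    by (intro chern_formula chern_torsion) (auto simp: chern_connection_def)
  then show ?thesis using L by (simp add: Q algebra_simps)
qed

lemma chern_z:
  assumes D: "chern_connection L br g J D" and L: "x \<in> L"
  shows "D x z = 0"
proof (rule vector_eqI)
  show "D x z \<in> L" using D L by (simp add: chern_connection_def hermitian_connection_def)
  show "g (D x z) t = g 0 t" if "t \<in> L" for t
    using chern_eq[OF D L z_closed that] that L g_commute[of "A t" z] g_commute[of "J (A t)" z] by simp
qed simp

lemma chern_N:
  assumes D: "chern_connection L br g J D" and L: "x \<in> N" "y \<in> L"
  shows "D x y = 0"
proof (rule vector_eqI)
  have x: "x \<in> L" using L N_D by simp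
  show "D x y \<in> L" using D x L by (simp add: chern_connection_def hermitian_connection_def)
  show "g (D x y) t = g 0 t" if "t \<in> L" for t
    using chern_eq[OF D x L(2) that] that N_D[OF L(1)] by simp
qed simp

text \<open>By the formula for \<open>D x z\<close>, \<open>D (J x) z = J (D x z)\<close>. Hence the curvature entry at \<open>(x, J x)\<close> that
pairs \<open>z\<close> with \<open>J z\<close> is \<open>- 2 |D x z|\<^sup>2\<close> for each \<open>x\<close> of a unitary triple, and the sum of these three
numbers is zero.\<close>

lemma s_eq_0_of_instanton:
  assumes D: "hermitian_connection L g J D" and inst: "instanton L br g J e D"
    and k: "k \<noteq> 0" "\<And>x t. \<lbrakk>x \<in> L; t \<in> L\<rbrakk> \<Longrightarrow> g (D x z) t = - k * s x t"
    and L: "x \<in> L" "y \<in> L"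
  shows "s x y = 0"
proof -
  obtain u v where u: "unitary_triple z u v" using unitary_triple_exists[of z] by auto
  note U = unitary_tripleD[OF u]
  note uN = unitary_triple_N[OF u]
  note hc = hc_closed[OF D] hc_J[OF D] hc_0[OF D]
  have DJ: "D (J x) z = J (D x z)" if "x \<in> L" for x
    by (rule vector_eqI) (use that hc k(2) in \<open>simp_all add: g_J_left s_J_left\<close>)
  have R: "g (curv D x (J x) z) (J z) = - 2 * g (D x z) (D x z)" if "x \<in> L" "br x (J x) = 0" for x
  proof -
    have "g (D x (D (J x) z)) (J z) = - g (D x z) (D x z)"
      using that hc by (subst hc_skew[OF D]) (simp_all add: DJ)
    moreover have "g (D (J x) (D x z)) (J z) = g (D x z) (D x z)"
      using that hc by (subst hc_skew[OF D]) (simp_all add: DJ)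
    ultimately show ?thesis using that hc by (simp add: curv_def)
  qed
  have "br z (J z) = 0" "br u (J u) = 0" "br v (J v) = 0"
    using N_D[OF uN(1)] N_D[OF uN(2)] by (simp_all add: br_ideal)
  then have "g (D z z) (D z z) + g (D u z) (D u z) + g (D v z) (D v z) = 0"
    using instanton_trace[OF D inst u z_closed, of "J z"] U by (simp add: R)
  moreover have "g (D z z) (D z z) \<ge> 0" "g (D u z) (D u z) \<ge> 0" "g (D v z) (D v z) \<ge> 0"
    using U hc g_nonneg by simp_all
  ultimately have "g (D u z) (D u z) = 0" "g (D v z) (D v z) = 0" by linarith+
  then have "D u z = 0" "D v z = 0" using U hc by (simp_all add: g_self_eq_0)
  then have 0: "s u t = 0" "s v t = 0" if "t \<in> L" for t
    using k(1) k(2)[of u t] k(2)[of v t] U that by simp_all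
  then have J0: "s (J u) t = 0" "s (J v) t = 0" if "t \<in> L" for t
    using that U by (simp_all add: s_J_left)
  have sub: "set [z, J z, u, J u, v, J v] \<subseteq> L" using U by simp
  show ?thesis
  proof (rule linear_on_zero_span[OF _ subspace sub, of "\<lambda>x. s x y"])
    show "linear_on L (\<lambda>x. s x y)" using L by (simp add: linear_on_def)
    show "s x y = 0" if "x \<in> set [z, J z, u, J u, v, J v]" for x
      using that 0 J0 L by auto
  qed (use L unitary_triple_span[OF u] in simp)
qed

section \<open>The anomaly equation\<close>

text \<open>In these terms \<open>d\<omega>\<close> is the wedge product of \<open>g z\<close> and \<open>\<gamma>\<close>, where \<open>\<gamma>\<close> has type \<open>(1,1)\<close>. Consequently
\<open>\<eta>\<close>, the \<open>(1,2)\<close>-part of \<open>d\<omega>\<close>, is the wedge product of the \<open>(0,1)\<close>-part \<open>\<theta>/2\<close> of \<open>g z\<close> with \<open>\<gamma>\<close>.\<close>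

definition \<gamma> :: "'v \<Rightarrow> 'v \<Rightarrow> real" where
  "\<gamma> x y = - s (J x) y"

definition \<eta> :: "'v form" where
  "\<eta> = delbar br J 1 1 \<omega>"

definition \<theta> :: "'v \<Rightarrow> complex" where
  "\<theta> x = of_real (g z x) + \<i> * of_real (g z (J x))"

lemma \<eta>_eq:
  assumes L: "x \<in> L" "y \<in> L" "t \<in> L"
  shows "\<eta> [x, y, t] = (\<theta> x * of_real (\<gamma> y t) - \<theta> y * of_real (\<gamma> x t) + \<theta> t * of_real (\<gamma> x y)) / 2"
proof -
  have \<eta>: "\<eta> [x, y, t] = type_part J 1 2 (ext_d br \<omega>) [x, y, t]"
    by (simp add: \<eta>_def delbar_def del: One_nat_def)
  show ?thesis
    unfolding \<eta> type_part_1_2 using L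
    by (simp add: ext_d_fundamental d\<omega>_eq \<theta>_def \<gamma>_def s_J_left field_simps)
qed

text \<open>The one-form \<open>\<theta>\<close> vanishes on \<open>N\<close>, so only the terms with \<open>\<theta> a\<close> or \<open>\<theta> b\<close> survive. The vectors \<open>a\<close> and \<open>b\<close>
will be \<open>z\<close> and \<open>J z\<close> and their images under \<open>J\<close>.\<close>

lemma ext_d_\<eta>:
  assumes L: "a \<in> L" "b \<in> L" and A0: "A a = 0" "A b = 0" and N: "x \<in> N" "y \<in> N"
  shows "ext_d br \<eta> [a, b, x, y] = - \<i> / 2 * of_real ((g z a * g z (J b) - g z b * g z (J a)) * (\<gamma> (A x) y - \<gamma> (A y) x))"
proof -
  note X = N_D[OF N(1)] and Y = N_D[OF N(2)]
  have br: "br a b = 0" "br a x = g z a *\<^sub>R A x" "br a y = g z a *\<^sub>R A y"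
    "br b x = g z b *\<^sub>R A x" "br b y = g z b *\<^sub>R A y" "br x y = 0"
    using br_eq[OF L] br_eq[OF L(1) X(1)] br_eq[OF L(1) Y(1)] br_eq[OF L(2) X(1)] br_eq[OF L(2) Y(1)]
      br_eq[OF X(1) Y(1)] A0 X Y by simp_all
  have g0: "\<gamma> (r *\<^sub>R p) q = r * \<gamma> p q" "\<gamma> 0 q = 0" "\<gamma> p (r *\<^sub>R q) = r * \<gamma> p q" if "p \<in> L" "q \<in> L" for p q r
    using that s_linear(3)[of q q 0] by (simp_all add: \<gamma>_def)
  show ?thesis
    unfolding ext_d_4 br using L X Y
    by (simp add: \<eta>_eq \<theta>_def g0 field_simps)
qed

text \<open>By the formula for \<open>d\<eta>\<close>, its value is unchanged when \<open>J\<close> is applied to both \<open>z\<close> and \<open>J z\<close> or to both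
\<open>x\<close> and \<open>J x\<close>, and it vanishes when \<open>J\<close> is applied to exactly one of \<open>z\<close> and \<open>J z\<close>. So the
\<open>(2,2)\<close>-part agrees with \<open>d\<eta>\<close> itself on these vectors.\<close>

lemma anomaly_form_eq:
  assumes x: "x \<in> N"
  shows "\<i> * del br J 1 2 \<eta> [z, J z, x, J x] = of_real (s (A x) x)"
proof -
  note X = N_D[OF x] and AX = N_D[OF A_in_N[OF N_D(1)[OF x]]]
  have m: "\<gamma> (A x) (J x) - \<gamma> (A (J x)) x = - 2 * s (A x) x"
    using X AX by (simp add: \<gamma>_def s_J_left s_commute[of x "A x"])
  have minus: "\<gamma> (- p) q = - \<gamma> p q" "\<gamma> p (- q) = - \<gamma> p q" if "p \<in> L" "q \<in> L" for p q
    using that by (simp_all add: \<gamma>_def)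
  have "del br J 1 2 \<eta> [z, J z, x, J x] = type_part J 2 2 (ext_d br \<eta>) [z, J z, x, J x]"
    by (simp add: del_def del: One_nat_def)
  also have "\<dots> = - \<i> * of_real (s (A x) x)"
    unfolding type_part_2_2 using X AX x N_J[OF x] m
    by (simp add: ext_d_\<eta> N_def minus)
  finally show ?thesis by simp
qed

text \<open>The curvature vanishes when one argument lies in \<open>N\<close>, and in each product of two curvature values on
these four vectors some factor has such an argument.\<close>

lemma chern_anomaly:
  assumes D: "chern_connection L br g J Dc" "\<And>x y. \<lbrakk>x \<in> L; y \<in> L\<rbrakk> \<Longrightarrow> D x y = Dc x y"
    and x: "x \<in> N"
  shows "tr_curv_square br g e D [z, J z, x, J x] = 0"
proof -
  have Dc: "hermitian_connection L g J Dc" using D by (simp add: chern_connection_def)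
  have herm: "hermitian_connection L g J D"
    using hermitian_connection_combination[OF Dc Dc, of D 1 0] D(2) by simp
  have DN: "D p v = 0" if "p \<in> N" "v \<in> L" for p v
    using chern_N[OF D(1) that] D(2) that N_D by simp
  have curv0: "curv D p q v = 0" "curv D q p v = 0" if "p \<in> N" "q \<in> L" "v \<in> L" for p q v
  proof -
    note P = N_D[OF that(1)]
    have "br p q \<in> N" "br q p \<in> N"
      using br_eq[OF P(1) that(2)] br_eq[OF that(2) P(1)] P that by (simp_all add: N_def)
    then show "curv D p q v = 0" "curv D q p v = 0"
      using that P herm by (simp_all add: curv_def DN)
  qed
  have "form_square (curv_form br g e D i j) [z, J z, x, J x] = 0" if "i \<in> {1..6}" "j \<in> {1..6}" for i j
    unfolding form_square_def using x N_D[OF x] N_J[OF x] that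
    by (subst wedge_2_2[OF curv_form_alternating[OF herm that] curv_form_alternating[OF herm that] subspace])
      (simp_all add: curv_form_eq[OF herm] curv0)
  then show ?thesis by (simp add: tr_curv_square_def)
qed

lemma s_A_self:
  assumes "\<And>n. n \<in> N \<Longrightarrow> s (A n) n = 0" and x: "x \<in> L"
  shows "s (A x) x = 0"
proof -
  define n where "n = x - g z x *\<^sub>R z - g (J z) x *\<^sub>R J z"
  have "n \<in> N" using x by (simp add: n_def N_def g_J_left[of z x])
  moreover have "s (A n) n = s (A x) x"
    using x s_commute[of "A x" z] s_commute[of "A x" "J z"]
    by (simp add: n_def s_linear(2)[of _ "- _"] flip: add_uminus_conv_diff)
  ultimately show ?thesis using assms(1) by simp
qed

text \<open>With \<open>a\<close> the matrix of \<open>A\<close> and \<open>S\<close> that of \<open>s\<close>, the matrix \<open>S\<close> is \<open>a\<close> plus its transpose and the traces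
add up to the sum of the products \<open>a k l * S k l\<close>. As \<open>S\<close> is symmetric, this is half the sum of the
squares of its entries.\<close>

lemma s_eq_0_of_trace:
  assumes 0: "\<And>x. x \<in> L \<Longrightarrow> s (A x) x = 0" and L: "x \<in> L" "y \<in> L"
  shows "s x y = 0"
proof -
  define a where "a k l = g (A (e k)) (e l)" for k l
  define S where "S k l = s (e k) (e l)" for k l
  have S: "S k l = a k l + a l k" if "k \<in> {1..6}" "l \<in> {1..6}" for k l
    using that e_closed g_commute[of "e k" "A (e l)"] by (simp add: S_def a_def s_def)
  have S_commute: "S k l = S l k" if "k \<in> {1..6}" "l \<in> {1..6}" for k l
    using S[OF that] S[OF that(2,1)] by simp
  have "(\<Sum>l\<in>{1..6}. a k l * S k l) = 0" if k: "k \<in> {1..6}" for k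
  proof -
    have ek: "e k \<in> L" "A (e k) \<in> L" using k by simp_all
    have "linear_on L (\<lambda>v. s v (e k))" using ek by (simp add: linear_on_def)
    then have "s (\<Sum>l\<in>{1..6}. g (A (e k)) (e l) *\<^sub>R e l) (e k) = (\<Sum>l\<in>{1..6}. a k l * s (e l) (e k))"
      using linear_on_sum[OF _ subspace, of "\<lambda>v. s v (e k)" "{1..6}" e] by (simp add: a_def)
    moreover have "s (A (e k)) (e k) = s (\<Sum>l\<in>{1..6}. g (A (e k)) (e l) *\<^sub>R e l) (e k)"
      using e_expand[OF ek(2)] by (rule arg_cong)
    moreover have "(\<Sum>l\<in>{1..6}. a k l * s (e l) (e k)) = (\<Sum>l\<in>{1..6}. a k l * S k l)"
      using k by (intro sum.cong refl) (simp add: S_def s_commute)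
    ultimately show ?thesis using 0[OF ek(1)] by simp
  qed
  then have left: "(\<Sum>k\<in>{1..6}. \<Sum>l\<in>{1..6}. a k l * S k l) = 0" by simp
  have "(\<Sum>k\<in>{1..6}. \<Sum>l\<in>{1..6}. a l k * S k l) = (\<Sum>l\<in>{1..6}. \<Sum>k\<in>{1..6}. a l k * S l k)"
    by (subst sum.swap) (intro sum.cong refl; simp only: S_commute)
  then have right: "(\<Sum>k\<in>{1..6}. \<Sum>l\<in>{1..6}. a l k * S k l) = 0" using left by simp
  have "(\<Sum>k\<in>{1..6}. \<Sum>l\<in>{1..6}. (S k l)\<^sup>2) = (\<Sum>k\<in>{1..6}. \<Sum>l\<in>{1..6}. a k l * S k l + a l k * S k l)"
    using S by (intro sum.cong refl) (simp add: power2_eq_square distrib_right)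
  also have "\<dots> = 0" using left right by (simp add: sum.distrib)
  finally have "S k l = 0" if "k \<in> {1..6}" "l \<in> {1..6}" for k l
    using that by (simp add: sum_nonneg_eq_0_iff sum_nonneg)
  then have basis: "s p q = 0" if "p \<in> e ` {1..6}" "q \<in> e ` {1..6}" for p q
    using that by (auto simp: S_def)
  have sub: "e ` {1..6} \<subseteq> L" by auto
  have 1: "s p q = 0" if "p \<in> L" "q \<in> e ` {1..6}" for p q
  proof (rule linear_on_zero_span[OF _ subspace sub, of "\<lambda>p. s p q"])
    have "q \<in> L" using that by auto
    then show "linear_on L (\<lambda>p. s p q)" by (simp add: linear_on_def)
  qed (use that basis e_span in auto)
  show ?thesis
  proof (rule linear_on_zero_span[OF _ subspace sub, of "s x"])
    show "linear_on L (s x)" using L by (simp add: linear_on_def)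
  qed (use L 1 e_span in auto)
qed

text \<open>The Chern part of \<open>D\<close> contributes nothing to \<open>D x z\<close>, the Bismut part \<open>- s x y / 2\<close> with weight
\<open>(1 - \<tau>) / 2\<close>. So the curvature detects \<open>s\<close> unless \<open>\<tau> = 1\<close>, and in this case the anomaly equation does.\<close>

theorem kaehler_of_anomaly_and_instanton:
  assumes D: "gauduchon_connection L br g J \<tau> D"
    and anomaly: "form_eq L 4 (\<lambda>Xs. \<i> * del br J 1 2 (delbar br J 1 1 \<omega>) Xs)
       (\<lambda>Xs. complex_of_real c * tr_curv_square br g e D Xs)"
    and inst: "instanton L br g J e D"
  shows "kaehler L br g J"
proof (rule kaehler_of_s_eq_0)
  fix x y assume L: "x \<in> L" "y \<in> L"
  obtain Dc Db where Dc: "chern_connection L br g J Dc" and Db: "bismut_connection L br g J Db"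
    and eq: "\<And>x y. \<lbrakk>x \<in> L; y \<in> L\<rbrakk> \<Longrightarrow> D x y = ((1 + \<tau>) / 2) *\<^sub>R Dc x y + ((1 - \<tau>) / 2) *\<^sub>R Db x y"
    using D unfolding gauduchon_connection_def by blast
  have hDc: "hermitian_connection L g J Dc" and hDb: "hermitian_connection L g J Db"
    using Dc Db by (simp_all add: chern_connection_def bismut_connection_def)
  have herm: "hermitian_connection L g J D"
    using hermitian_connection_combination[OF hDc hDb eq] .
  show "s x y = 0"
  proof (cases "\<tau> = 1")
    case False
    show ?thesis
    proof (rule s_eq_0_of_instanton[OF herm inst, of "(1 - \<tau>) / 4"])
      show "g (D p z) t = - ((1 - \<tau>) / 4) * s p t" if "p \<in> L" "t \<in> L" for p t
        using that hc_closed[OF hDb] bismut_z[OF Db that] by (simp add: eq chern_z[OF Dc])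
    qed (use False L in simp_all)
  next
    case True
    then have D_eq: "D p q = Dc p q" if "p \<in> L" "q \<in> L" for p q using that by (simp add: eq)
    have "s (A n) n = 0" if n: "n \<in> N" for n
    proof -
      have "\<i> * del br J 1 2 \<eta> [z, J z, n, J n] = complex_of_real c * tr_curv_square br g e D [z, J z, n, J n]"
        using anomaly N_D[OF n] unfolding \<eta>_def form_eq_def by (elim allE[of _ "[z, J z, n, J n]"]) simp
      moreover have "tr_curv_square br g e D [z, J z, n, J n] = 0"
        by (rule chern_anomaly[OF Dc _ n]) (rule D_eq)
      ultimately have "complex_of_real (s (A n) n) = 0"
        unfolding anomaly_form_eq[OF n] by simp
      then show ?thesis by (simp only: of_real_eq_0_iff)
    qed
    then have "s (A p) p = 0" if "p \<in> L" for p using that by (rule s_A_self)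
    then show ?thesis using L by (rule s_eq_0_of_trace)
  qed
qed

end

section \<open>Passage to the Lie group\<close>

text \<open>The components of \<open>x\<close> and \<open>y\<close> in the abelian ideal commute, and this is the normal form of the bracket
required by \<open>almost_abelian_hermitian\<close>. The two conditions that remain then give \<open>A (J z) = 0\<close>.\<close>

theorem (in hermitian_algebra_6) kaehler_of_hull_strominger_and_instanton:
  assumes aa: "almost_abelian L br" and \<Psi>: "holomorphic_volume_form L br J \<Psi>"
    and D: "gauduchon_connection L br g J \<tau> D"
    and anomaly: "form_eq L 4 (\<lambda>Xs. \<i> * del br J 1 2 (delbar br J 1 1 \<omega>) Xs)
       (\<lambda>Xs. complex_of_real c * tr_curv_square br g e D Xs)"
    and conf: "form_eq L 5 (ext_d br (\<lambda>Xs. complex_of_real (volume_norm L \<omega> \<Psi>) * form_square \<omega> Xs)) (\<lambda>_. 0)"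
    and inst: "instanton L br g J e D"
  shows "kaehler L br g J"
proof -
  obtain I where I: "subspace I" "I \<subseteq> L" "dim L = dim I + 1"
    and ideal: "\<And>x y. \<lbrakk>x \<in> L; y \<in> I\<rbrakk> \<Longrightarrow> br x y \<in> I"
    and abelian: "\<And>x y. \<lbrakk>x \<in> I; y \<in> I\<rbrakk> \<Longrightarrow> br x y = 0"
    using aa unfolding almost_abelian_def by blast
  obtain z where z: "z \<in> L" "g z z = 1" "\<And>x. x \<in> I \<Longrightarrow> g z x = 0" "\<And>x. \<lbrakk>x \<in> L; g z x = 0\<rbrakk> \<Longrightarrow> x \<in> I"
    using unit_normal_exists[OF I] by blast
  let ?p = "\<lambda>x. x - g z x *\<^sub>R z"
  have p: "?p x \<in> I" if "x \<in> L" for x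
    using that z(1,2) by (intro z(4)) simp_all
  have brz: "br z x = br z (?p x)" if "x \<in> L" for x
    using that z(1,2) br_self[OF z(1)] by simp
  have brz_I: "br z x \<in> I" if "x \<in> L" for x
    using ideal[OF z(1) p[OF that]] brz[OF that] by simp
  interpret almost_abelian_hermitian L br g J e z
  proof
    show "br z x \<in> L" if "x \<in> L" for x using brz_I[OF that] I(2) by auto
    show "g z (br z x) = 0" if "x \<in> L" for x using brz_I[OF that] z(3) by simp
    show "br x y = g z x *\<^sub>R br z y - g z y *\<^sub>R br z x" if "x \<in> L" "y \<in> L" for x y
    proof -
      have comm: "br x z = - br z x" and zz: "br z z = 0"
        using that z(1) br_commute[of x z] br_self by simp_all
      have "br (?p x) (?p y) = br x y - g z x *\<^sub>R br z y - g z y *\<^sub>R (br x z - g z x *\<^sub>R br z z)"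
        using that z(1) by (simp add: scaleR_diff_right)
      also have "\<dots> = br x y + g z y *\<^sub>R br z x - g z x *\<^sub>R br z y"
        unfolding comm zz by simp
      finally have "br x y + g z y *\<^sub>R br z x - g z x *\<^sub>R br z y = 0"
        using abelian[OF p[OF that(1)] p[OF that(2)]] by (simp only:)
      then show ?thesis by (simp add: eq_diff_eq)
    qed
  qed (use z(1,2) in simp_all)
  interpret almost_abelian_balanced L br g J e z
  proof
    show "br z (J z) = 0"
      by (rule A_Jz_eq_0_of_holomorphic[OF balanced_of_conformally_balanced[OF \<Psi> conf] \<Psi>])
  qed
  show ?thesis by (rule kaehler_of_anomaly_and_instanton[OF D anomaly inst])
qed

text \<open>A vector field is linear on smooth functions only. Since it is zero on the other functions and maps
\<open>0\<close> to \<open>0\<close>, it is additive and homogeneous on all functions of the form \<open>Y f\<close>.\<close>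

lemma bilinear_lie_bracket:
  assumes L: "L = lie_algebra A mul"
  shows "bilinear_on L lie_bracket" and "X \<in> L \<Longrightarrow> lie_bracket X X = 0"
proof -
  have X: "vector_field A X" if "X \<in> L" for X using that by (simp add: L lie_algebra_def)
  have 0: "X 0 = 0" if "X \<in> L" for X
  proof (cases "0 \<in> smooth_functions A")
    case True
    then have "X (0 *\<^sub>R 0) = 0 *\<^sub>R X 0" using X[OF that] unfolding vector_field_def by blast
    then show ?thesis by simp
  next
    case False
    then show ?thesis using X[OF that] unfolding vector_field_def by blast
  qed
  have nonsmooth: "X f = 0" if "X \<in> L" "f \<notin> smooth_functions A" for X f
    using X[OF that(1)] that(2) unfolding vector_field_def by blast
  have add: "X (Y f + Z f) = X (Y f) + X (Z f)" if "X \<in> L" "Y \<in> L" "Z \<in> L" for X Y Z f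
  proof (cases "f \<in> smooth_functions A")
    case True
    then have "Y f \<in> smooth_functions A" "Z f \<in> smooth_functions A"
      using X that unfolding vector_field_def by blast+
    then show ?thesis using X[OF that(1)] unfolding vector_field_def by blast
  next
    case False
    show ?thesis
      by (simp only: nonsmooth[OF that(2) False] nonsmooth[OF that(3) False] 0[OF that(1)] add_0)
  qed
  have scale: "X (r *\<^sub>R Y f) = r *\<^sub>R X (Y f)" if "X \<in> L" "Y \<in> L" for X Y r f
  proof (cases "f \<in> smooth_functions A")
    case True
    then have "Y f \<in> smooth_functions A" using X that unfolding vector_field_def by blast
    then show ?thesis using X[OF that(1)] unfolding vector_field_def by blast
  next
    case False
    show ?thesis
      by (simp only: nonsmooth[OF that(2) False] 0[OF that(1)] scaleR_zero_right)
  qed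
  have plus: "(Y + Z) f = Y f + Z f" and times: "(r *\<^sub>R Y) f = r *\<^sub>R Y f" for Y Z :: "'a vfield" and f r
    by (simp_all add: scaleR_fun_def)
  have bracket: "lie_bracket X Y f = X (Y f) - Y (X f)" for X Y :: "'a vfield" and f
    by (simp only: lie_bracket_def)
  show "bilinear_on L lie_bracket"
    unfolding bilinear_on_def linear_on_def
  proof (intro ballI conjI allI)
    fix X Y Z assume XYZ: "X \<in> L" "Y \<in> L" "Z \<in> L"
    show "lie_bracket X (Y + Z) = lie_bracket X Y + lie_bracket X Z"
    proof (rule ext)
      show "(lie_bracket X (Y + Z)) f = (lie_bracket X Y + lie_bracket X Z) f" for f
        unfolding plus bracket add[OF XYZ] by (rule add_diff_add)
    qed
    show "lie_bracket (Y + Z) X = lie_bracket Y X + lie_bracket Z X"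
    proof (rule ext)
      show "(lie_bracket (Y + Z) X) f = (lie_bracket Y X + lie_bracket Z X) f" for f
        unfolding plus bracket add[OF XYZ] by (rule add_diff_add)
    qed
  next
    fix X Y and r :: real assume XY: "X \<in> L" "Y \<in> L"
    show "lie_bracket X (r *\<^sub>R Y) = r *\<^sub>R lie_bracket X Y"
    proof (rule ext)
      show "(lie_bracket X (r *\<^sub>R Y)) f = (r *\<^sub>R lie_bracket X Y) f" for f
        unfolding times bracket scale[OF XY] by (rule scaleR_diff_right[symmetric])
    qed
    show "lie_bracket (r *\<^sub>R Y) X = r *\<^sub>R lie_bracket Y X"
    proof (rule ext)
      show "(lie_bracket (r *\<^sub>R Y) X) f = (r *\<^sub>R lie_bracket Y X) f" for f
        unfolding times bracket scale[OF XY] by (rule scaleR_diff_right[symmetric])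
    qed
  qed
  show "lie_bracket X X = 0" if "X \<in> L"
  proof (rule ext)
    show "lie_bracket X X f = 0 f" for f unfolding bracket by simp
  qed
qed

theorem theorem3p4:
  fixes A :: "('g::{t2_space, second_countable_topology}, real ^ 6) chart set"
    and mul :: "'g \<Rightarrow> 'g \<Rightarrow> 'g" and one :: 'g and inv :: "'g \<Rightarrow> 'g"
    and L :: "'g vfield set"
    and g :: "'g vfield \<Rightarrow> 'g vfield \<Rightarrow> real"
    and J :: "'g vfield \<Rightarrow> 'g vfield"
    and \<Psi> :: "'g vfield form"
    and e :: "nat \<Rightarrow> 'g vfield"
    and D :: "'g vfield \<Rightarrow> 'g vfield \<Rightarrow> 'g vfield"
    and \<tau> \<alpha>' :: real
  assumes "lie_group A mul one inv"
    and "L = lie_algebra A mul"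
    and "almost_abelian L lie_bracket"
    and "hermitian_structure L lie_bracket g J"
    and "holomorphic_volume_form L lie_bracket J \<Psi>"
    and "orthonormal_frame L g 6 e"
    and "gauduchon_connection L lie_bracket g J \<tau> D"
    and "hull_strominger_flat L lie_bracket g J \<Psi> e D \<alpha>'"
    and "instanton L lie_bracket g J e D"
  shows "kaehler L lie_bracket g J"
proof -
  have "subspace L"
    using assms(6) subspace_span[of "e ` {1..6}"] by (simp add: orthonormal_frame_def)
  then interpret hermitian_algebra_6 L lie_bracket g J e
    by (intro hermitian_algebra_6.intro hermitian_algebra.intro hermitian_algebra_6_axioms.intro
        bilinear_lie_bracket[OF assms(2)] assms(4,6))
  note system = assms(8)[unfolded hull_strominger_flat_def Let_def]
  show ?thesis
    by (rule kaehler_of_hull_strominger_and_instanton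
        [OF assms(3,5,7) conjunct1[OF system] conjunct2[OF system] assms(9)])
qed

end
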